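(* Each of the four cellular automata $\mathsf{R}$, $\mathsf{F}$, $\mathsf{M}$, $\mathsf{T}$ defined below is a robust memory under synchronous updates. That is, for each $\mathcal{A}\in\{\mathsf{R},\mathsf{F},\mathsf{M},\mathsf{T}\}$ there is an open ball $U$ in the $(p,\eta)$ parameter plane, whose radius does not depend on $L$, such that for every $(p,\eta)\in U$ the memory time of the noisy synchronous dynamics of $\mathcal{A}$ on the $L\times L$ torus satisfies $\lim_{L\to\infty} t_{\rm mem}=\infty$.
   Context: Spins $s_{\mathbf r}\in\{+1,-1\}$ live on the sites $\mathbf r\in(\mathbb Z/L\mathbb Z)^2$ of an $L\times L$ square lattice with periodic boundary conditions; $\hat{\mathbf x}=(1,0)$, $\hat{\mathbf y}=(0,1)$. A spin $+1$ is treated as Boolean true and $-1$ as false, so $a\wedge b=\min(a,b)$ and $a\vee b=\max(a,b)$. Time $t$ is discrete. The noiseless rules (all spins updated simultaneously at each time step, using the configuration at time $t$) are: $\mathsf{R}$: $s_{\mathbf r}(t+1)=s_{\mathbf r+\hat{\mathbf y}}\wedge s_{\mathbf r}\wedge s_{\mathbf r-\hat{\mathbf y}}$ for $t$ even, and $s_{\mathbf r+\hat{\mathbf x}}\vee s_{\mathbf r}\vee s_{\mathbf r-\hat{\mathbf x}}$ for $t$ odd. $\mathsf{F}$: $s_{\mathbf r}(t+1)=s_{\mathbf r+\hat{\mathbf x}}\vee s_{\mathbf r-\hat{\mathbf x}-\hat{\mathbf y}}$ for $t$ even, and $s_{\mathbf r+\hat{\mathbf x}+\hat{\mathbf y}}\wedge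 s_{\mathbf r-\hat{\mathbf y}}$ for $t$ odd. $\mathsf{M}$: $s_{\mathbf r}(t+1)=s_{\mathbf r+\hat{\mathbf x}}\vee s_{\mathbf r+\hat{\mathbf y}}$ for $t$ even, and $s_{\mathbf r+\hat{\mathbf x}}\wedge s_{\mathbf r-\hat{\mathbf y}}$ for $t$ odd. $\mathsf{T}$: $s_{\mathbf r}(t+1)=s_{\mathbf r}\vee s_{\mathbf r+\hat{\mathbf x}}\vee s_{\mathbf r-\hat{\mathbf y}}$ for $t$ even, and $s_{\mathbf r}\wedge s_{\mathbf r+\hat{\mathbf x}}\wedge s_{\mathbf r-\hat{\mathbf y}}$ for $t$ odd. Noisy synchronous dynamics with noise strength $p\in[0,1]$ and bias $\eta\in[-1,1]$: at each time step, independently for each site, $s_{\mathbf r}(t+1)$ is set to the value given by the noiseless rule with probability $1-p$, and otherwise is set to $+1$ with probability $p(1+\eta)/2$ and to $-1$ with probability $p(1-\eta)/2$. Let $s_\pm$ denote the all-$(\pm1)$ configurations and $m(s)=L^{-2}\sum_{\mathbf r}s_{\mathbf r}$ the magnetization. The memory time is $t_{\rm mem}=\mathbb E\,\min_{\pm}\{t : \pm m[\mathcal A^t(s_\pm)]<1/2\}$, i.e. the expected (over noise realizations) first time at which the magnetization, starting from a logical state $s_\pm$, has relaxed below half its initial value in absolute value (minimized over the two choices of initial logical state). $\mathcal A$ is a robust memory if there is an open ball in the $(p,\eta)$ plane, with radius remaining finite as $L\to\infty$, on which $\lim_{L\to\infty}t_{\rm mem}=\infty$. *)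

theory Defs
  imports "HOL-Probability.Probability"
begin

text \<open>Sites of the L x L torus are pairs (i,j) with i,j < L; spin +1 is True, -1 is False.
  A configuration is a function on sites (values outside the torus are irrelevant).\<close>

type_synonym site = "nat \<times> nat"
type_synonym config = "site \<Rightarrow> bool"

datatype CA = CA_R | CA_F | CA_M | CA_T

definition shift :: "nat \<Rightarrow> site \<Rightarrow> int \<Rightarrow> int \<Rightarrow> site" where
  "shift L r dx dy = (nat ((int (fst r) + dx) mod int L), nat ((int (snd r) + dy) mod int L))"

fun rule :: "CA \<Rightarrow> nat \<Rightarrow> nat \<Rightarrow> config \<Rightarrow> site \<Rightarrow> bool" where
  "rule CA_R L t s r = (if even t
      then s (shift L r 0 1) \<and> s r \<and> s (shift L r 0 (-1))
      else s (shift L r 1 0) \<or> s r \<or> s (shift L r (-1) 0))"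
| "rule CA_F L t s r = (if even t
      then s (shift L r 1 0) \<or> s (shift L r (-1) (-1))
      else s (shift L r 1 1) \<and> s (shift L r 0 (-1)))"
| "rule CA_M L t s r = (if even t
      then s (shift L r 1 0) \<or> s (shift L r 0 1)
      else s (shift L r 1 0) \<and> s (shift L r 0 (-1)))"
| "rule CA_T L t s r = (if even t
      then s r \<or> s (shift L r 1 0) \<or> s (shift L r 0 (-1))
      else s r \<and> s (shift L r 1 0) \<and> s (shift L r 0 (-1)))"

text \<open>Noise at one site and time: None = apply the noiseless rule (prob. 1-p);
  Some True = set to +1 (prob. p(1+eta)/2); Some False = set to -1 (prob. p(1-eta)/2).\<close>
definition noise_pmf :: "real \<Rightarrow> real \<Rightarrow> bool option pmf" where
  "noise_pmf p \<eta> = do {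
     b \<leftarrow> bernoulli_pmf p;
     if b then map_pmf Some (bernoulli_pmf ((1 + \<eta>) / 2)) else return_pmf None }"

type_synonym noise = "nat \<times> site \<Rightarrow> bool option"

definition noise_space :: "real \<Rightarrow> real \<Rightarrow> noise measure" where
  "noise_space p \<eta> = PiM UNIV (\<lambda>_. measure_pmf (noise_pmf p \<eta>))"

fun evolve :: "CA \<Rightarrow> nat \<Rightarrow> noise \<Rightarrow> nat \<Rightarrow> config \<Rightarrow> config" where
  "evolve A L w 0 s = s"
| "evolve A L w (Suc t) s = (\<lambda>r. case w (t, r) of
       None \<Rightarrow> rule A L t (evolve A L w t s) r
     | Some v \<Rightarrow> v)"

definition torus :: "nat \<Rightarrow> site set" where
  "torus L = {0..<L} \<times> {0..<L}"

definition magn :: "nat \<Rightarrow> config \<Rightarrow> real" where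
  "magn L s = (\<Sum>r\<in>torus L. if s r then 1 else -1) / real (L ^ 2)"

definition first_time :: "(nat \<Rightarrow> bool) \<Rightarrow> ennreal" where
  "first_time P = (if \<exists>t. P t then of_nat (LEAST t. P t) else \<infinity>)"

definition relax_time :: "CA \<Rightarrow> nat \<Rightarrow> noise \<Rightarrow> ennreal" where
  "relax_time A L w = min
     (first_time (\<lambda>t. magn L (evolve A L w t (\<lambda>_. True)) < 1/2))
     (first_time (\<lambda>t. - magn L (evolve A L w t (\<lambda>_. False)) < 1/2))"

definition t_mem :: "CA \<Rightarrow> nat \<Rightarrow> real \<Rightarrow> real \<Rightarrow> ennreal" where
  "t_mem A L p \<eta> = (\<integral>\<^sup>+ w. relax_time A L w \<partial>noise_space p \<eta>)"

definition robust_memory :: "CA \<Rightarrow> bool" where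
  "robust_memory A \<longleftrightarrow> (\<exists>c r. r > 0 \<and> ball c r \<subseteq> {0..1} \<times> {-1..1} \<and>
     (\<forall>(p, \<eta>) \<in> ball (c :: real \<times> real) r. ((\<lambda>L. t_mem A L p \<eta>) \<longlongrightarrow> \<infinity>) sequentially))"

end

theory Submission
  imports Defs "HOL-Real_Asymp.Real_Asymp"
begin

text \<open>
  A Peierls argument in the spirit of Toom. Fix the initial state \<open>b\<close> and call a space-time
  point an error if its spin differs from \<open>b\<close>. In every second time step an error that is not
  caused by noise forces all points of its neighbourhood to be errors one step earlier; in the other
  steps it forces at least one of them. For each automaton there are three functionals on space-time with
  bounded sum such that every non-noise error has, for each functional, a predecessor error on which
  that functional is larger by at least 2.

  Add the errors of a past cone one at a time in order of time and keep a partition of them into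
  classes with the following property: for any choice of one pole per functional in a class, some closed
  walk in the class visits all poles, and its length plus the sum of the functionals at their poles is
  at most a constant times the number of noise points on the walk, minus a constant. A new error
  first merges the classes of its predecessors. A merge costs a bounded amount, because the sum of the
  functionals is bounded, and it is paid for by the subtracted constant; appending the new error itself
  costs a detour of length 2, which is paid for by the gain of the functionals. Hence an error lies on
  a closed walk on which noise has positive density, and counting walks bounds its probability
  uniformly in time by \<open>O(p)\<close>.

  For a bounded time horizon, distant sites depend on disjoint parts of the noise. Chebyshev's
  inequality then shows that, as \<open>L\<close> grows, the magnetization stays above one half up to any
  given time with probability tending to one.
\<close>

section \<open>Explanation of errors by closed walks\<close>

definition tour :: "('v \<Rightarrow> 'v \<Rightarrow> bool) \<Rightarrow> 'v \<Rightarrow> nat \<Rightarrow> 'v set \<Rightarrow> bool" where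
  "tour R x n S \<longleftrightarrow> (\<exists>ws. length ws = n \<and> successively R (x # ws) \<and> last (x # ws) = x \<and> set (x # ws) = S)"

lemma tour_single: "tour R x 0 {x}"
  by (auto simp: tour_def)

lemma tour_finite: "tour R x n S \<Longrightarrow> finite S"
  by (auto simp: tour_def)

lemma tour_concat:
  assumes "tour R x n S" and "tour R x m T"
  shows "tour R x (n + m) (S \<union> T)"
proof -
  obtain us where us: "length us = n" "successively R (x # us)" "last (x # us) = x" "set (x # us) = S"
    using assms(1) by (auto simp: tour_def)
  obtain vs where vs: "length vs = m" "successively R (x # vs)" "last (x # vs) = x" "set (x # vs) = T"
    using assms(2) by (auto simp: tour_def)
  have "successively R ((x # us) @ vs)"
    using us(2,3) vs(2) unfolding successively_append_iff by (cases vs) auto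
  moreover have "last (x # us @ vs) = x"
    using us(3) vs(3) by (cases "vs = []") auto
  ultimately show ?thesis
    unfolding tour_def using us vs by (intro exI[of _ "us @ vs"]) auto
qed

lemma tour_extend:
  assumes "tour R y n S" "R x y" "R y x"
  shows "tour R x (n + 2) (insert x S)"
proof -
  obtain us where us: "length us = n" "successively R (y # us)" "last (y # us) = y" "set (y # us) = S"
    using assms(1) by (auto simp: tour_def)
  have "successively R ((y # us) @ [x])"
    using us assms(2,3) unfolding successively_append_iff by auto
  then have "successively R (x # (y # us) @ [x])"
    using assms(2) by simp
  then show ?thesis
    unfolding tour_def using us by (intro exI[of _ "(y # us) @ [x]"]) auto
qed

text \<open>Cut the walk at an occurrence of \<open>y\<close> and swap the two pieces; being closed,
  the walk fits together again at \<open>x\<close>. This moves the base point to wherever two walks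
  are to be joined.\<close>

lemma tour_rotate:
  assumes "tour R x n S" "y \<in> S"
  shows "tour R y n S"
proof (cases "y = x")
  case False
  obtain us where us: "length us = n" "successively R (x # us)" "last (x # us) = x" "set (x # us) = S"
    using assms(1) by (auto simp: tour_def)
  then have "y \<in> set us"
    using assms(2) False by auto
  then obtain as bs where ab: "us = as @ y # bs"
    by (meson split_list)
  have l: "last (y # bs) = x"
    using us(3) ab by simp
  have "successively R ((x # as @ [y]) @ bs)" "successively R ((x # as) @ y # bs)"
    using us(2) unfolding ab by simp_all
  then have "successively R (x # as @ [y])" "successively R (y # bs)"
    unfolding successively_append_iff by auto
  then have "successively R ((y # bs) @ as @ [y])"
    using l successively_append_iff[of R "y # bs" "as @ [y]"] by (cases as) auto
  moreover have "set (y # bs @ as @ [y]) = S"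
    using us(4) l unfolding ab by (cases bs rule: rev_cases) (auto split: if_splits)
  ultimately show ?thesis
    unfolding tour_def using us(1) ab by (intro exI[of _ "bs @ as @ [y]"]) auto
qed (use assms in simp)

lemma tour_join:
  assumes "tour R a n S" "tour R b m T" "x \<in> S" "y \<in> T" "R x y" "R y x"
  shows "tour R x (n + m + 2) (S \<union> T)"
proof -
  have "tour R x (m + 2) (insert x T)"
    using assms tour_rotate tour_extend by metis
  then have "tour R x (n + (m + 2)) (S \<union> insert x T)"
    using assms tour_rotate tour_concat by metis
  then show ?thesis
    using assms(3) by (simp add: insert_absorb add.assoc)
qed

section \<open>Amortised accounting of walk length against noise points\<close>

locale Toom_functionals =
  fixes R :: "'v \<Rightarrow> 'v \<Rightarrow> bool"
    and I :: "'i set"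
    and \<Lambda> :: "'i \<Rightarrow> 'v \<Rightarrow> real"
    and c\<^sub>0 c :: real
  assumes R_sym: "R u v \<Longrightarrow> R v u"
    and fin_I: "finite I" and ne_I: "I \<noteq> {}"
    and sum_bound: "\<bar>\<Sum>s\<in>I. \<Lambda> s v\<bar> \<le> c\<^sub>0"
    and c_nonneg: "0 \<le> c"
    and R_bound: "R u v \<Longrightarrow> (\<Sum>s\<in>I. \<bar>\<Lambda> s u - \<Lambda> s v\<bar>) \<le> c"
begin

text \<open>The price of joining two walks: 2 steps to cross an edge and return,
  \<open>c\<^sub>0\<close> for one surplus copy of the functionals at the junction, and
  \<open>c\<close> for their change along the edge.\<close>

definition merge_cost :: real where
  "merge_cost = 2 + c\<^sub>0 + c"

text \<open>Chosen so that a single noise point with the trivial walk meets the inequality of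
  \<open>explained\<close>: its net credit \<open>noise_weight - merge_cost\<close> is
  \<open>c\<^sub>0\<close>, the bound on the functionals summed at one point.\<close>

definition noise_weight :: real where
  "noise_weight = merge_cost + c\<^sub>0"

text \<open>Allowing every choice of poles \<open>v\<close> is what makes the induction work: a pole
  in another class or on a new error can be replaced by a point of this class. The term
  \<open>- merge_cost\<close> is credit saved for a later merge.\<close>

definition explained :: "'v set \<Rightarrow> 'v set \<Rightarrow> bool" where
  "explained E C \<longleftrightarrow> (\<forall>v. (\<forall>s\<in>I. v s \<in> C) \<longrightarrow>
     (\<exists>x n S. tour R x n S \<and> S \<subseteq> C \<and> (\<forall>s\<in>I. v s \<in> S) \<and>
        real n + (\<Sum>s\<in>I. \<Lambda> s (v s)) \<le> noise_weight * card (S \<inter> E) - merge_cost))"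

lemma explainedE:
  assumes "explained E C" "\<forall>s\<in>I. v s \<in> C"
  obtains x n S where "tour R x n S" "S \<subseteq> C" "\<forall>s\<in>I. v s \<in> S"
    "real n + (\<Sum>s\<in>I. \<Lambda> s (v s)) \<le> noise_weight * card (S \<inter> E) - merge_cost"
  using assms unfolding explained_def by blast

lemma explained_noise:
  assumes "u \<in> E"
  shows "explained E {u}"
  unfolding explained_def
proof (intro allI impI)
  fix v assume v: "\<forall>s\<in>I. v s \<in> {u}"
  have "(\<Sum>s\<in>I. \<Lambda> s (v s)) = (\<Sum>s\<in>I. \<Lambda> s u)"
    using v by (intro sum.cong) auto
  also have "\<dots> \<le> c\<^sub>0"
    using sum_bound[of u] by linarith
  finally show "\<exists>x n S. tour R x n S \<and> S \<subseteq> {u} \<and> (\<forall>s\<in>I. v s \<in> S) \<and>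
        real n + (\<Sum>s\<in>I. \<Lambda> s (v s)) \<le> noise_weight * card (S \<inter> E) - merge_cost"
    using assms v by (intro exI[of _ u] exI[of _ "0::nat"] exI[of _ "{u}"])
      (auto simp: tour_single noise_weight_def)
qed

text \<open>If poles lie in both classes, substitute \<open>x\<close> or \<open>y\<close> for those
  missing from a class and join the two walks along the edge between \<open>x\<close> and
  \<open>y\<close>. Each class holds a credit of \<open>merge_cost\<close>; one pays for the join,
  the other is kept.\<close>

lemma explained_Un:
  assumes C: "explained E C" and D: "explained E D" and disj: "C \<inter> D = {}"
    and xy: "x \<in> C" "y \<in> D" "R x y"
  shows "explained E (C \<union> D)"
  unfolding explained_def
proof (intro allI impI)
  fix v assume v: "\<forall>s\<in>I. v s \<in> C \<union> D"
  let ?P = "\<lambda>B. \<exists>a n S. tour R a n S \<and> S \<subseteq> B \<and> (\<forall>s\<in>I. v s \<in> S) \<and>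
        real n + (\<Sum>s\<in>I. \<Lambda> s (v s)) \<le> noise_weight * card (S \<inter> E) - merge_cost"
  consider "\<forall>s\<in>I. v s \<in> C" | "\<forall>s\<in>I. v s \<in> D"
    | s s' where "s \<in> I" "v s \<notin> C" "s' \<in> I" "v s' \<notin> D"
    by blast
  then show "?P (C \<union> D)"
  proof cases
    case 1
    then have "?P C" using C by (auto simp: explained_def)
    then show ?thesis by blast
  next
    case 2
    then have "?P D" using D by (auto simp: explained_def)
    then show ?thesis by blast
  next
    case 3
    define v1 where "v1 s = (if v s \<in> C then v s else x)" for s
    define v2 where "v2 s = (if v s \<in> C then y else v s)" for s
    have v12: "\<forall>s\<in>I. v1 s \<in> C" "\<forall>s\<in>I. v2 s \<in> D"
      using v xy by (auto simp: v1_def v2_def)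
    obtain a n S where
      S: "tour R a n S" "S \<subseteq> C" "\<forall>s\<in>I. v1 s \<in> S"
        "real n + (\<Sum>s\<in>I. \<Lambda> s (v1 s)) \<le> noise_weight * card (S \<inter> E) - merge_cost"
      using explainedE[OF C v12(1)] .
    obtain b m T where
      T: "tour R b m T" "T \<subseteq> D" "\<forall>s\<in>I. v2 s \<in> T"
        "real m + (\<Sum>s\<in>I. \<Lambda> s (v2 s)) \<le> noise_weight * card (T \<inter> E) - merge_cost"
      using explainedE[OF D v12(2)] .
    \<comment> \<open>Some pole lies outside \<open>C\<close> and some outside \<open>D\<close>, so
      \<open>x\<close> and \<open>y\<close> both occur as substitutes and are visited.\<close>
    have "x \<in> S" "y \<in> T"
      using 3 S(3) T(3) v by (force simp: v1_def v2_def split: if_splits)+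
    then have tour: "tour R x (n + m + 2) (S \<union> T)"
      using tour_join S(1) T(1) xy(3) R_sym by metis
    have card: "card ((S \<union> T) \<inter> E) = card (S \<inter> E) + card (T \<inter> E)"
      unfolding Int_Un_distrib2
      using tour_finite[OF S(1)] tour_finite[OF T(1)] S(2) T(2) disj by (intro card_Un_disjoint) auto
    \<comment> \<open>The substitutes are \<open>y\<close> for poles in \<open>C\<close> and
      \<open>x\<close> for the others; exchanging each \<open>y\<close> for \<open>x\<close> costs
      at most the change along the edge.\<close>
    have "(\<Sum>s\<in>I. \<Lambda> s (v s)) + (\<Sum>s\<in>I. \<Lambda> s x) - (\<Sum>s\<in>I. \<bar>\<Lambda> s x - \<Lambda> s y\<bar>)
      = (\<Sum>s\<in>I. \<Lambda> s (v s) + \<Lambda> s x - \<bar>\<Lambda> s x - \<Lambda> s y\<bar>)"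
      by (simp add: sum.distrib sum_subtractf)
    also have "\<dots> \<le> (\<Sum>s\<in>I. \<Lambda> s (v1 s) + \<Lambda> s (v2 s))"
      by (intro sum_mono) (auto simp: v1_def v2_def)
    finally have "(\<Sum>s\<in>I. \<Lambda> s (v s)) - c\<^sub>0 - c \<le> (\<Sum>s\<in>I. \<Lambda> s (v1 s)) + (\<Sum>s\<in>I. \<Lambda> s (v2 s))"
      using sum_bound[of x] R_bound[OF xy(3)] by (simp add: sum.distrib)
    then have "real (n + m + 2) + (\<Sum>s\<in>I. \<Lambda> s (v s)) \<le> noise_weight * card ((S \<union> T) \<inter> E) - merge_cost"
      using S(4) T(4) unfolding card by (simp add: merge_cost_def algebra_simps)
    moreover have "\<forall>s\<in>I. v s \<in> S \<union> T"
      using S(3) T(3) v by (auto simp: v1_def v2_def split: if_splits)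
    ultimately show ?thesis
      using tour S(2) T(2) by (intro exI[of _ x] exI[of _ "n + m + 2"] exI[of _ "S \<union> T"]) auto
  qed
qed

text \<open>A pole at \<open>u\<close> is replaced by the predecessor on which its functional is
  larger by at least 2; one such gain pays for the detour of length 2 to \<open>u\<close>. As
  \<open>u\<close> is not noise, the noise count stays the same.\<close>

lemma explained_insert:
  assumes C: "explained E C" and u: "u \<notin> C" "u \<notin> E"
    and y: "\<And>s. s \<in> I \<Longrightarrow> y s \<in> C \<and> R u (y s) \<and> \<Lambda> s u + 2 \<le> \<Lambda> s (y s)"
  shows "explained E (insert u C)"
  unfolding explained_def
proof (intro allI impI)
  fix v assume v: "\<forall>s\<in>I. v s \<in> insert u C"
  define w where "w s = (if v s = u then y s else v s)" for s
  have w: "\<forall>s\<in>I. w s \<in> C"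
    using v y by (auto simp: w_def)
  obtain a n S where
    S: "tour R a n S" "S \<subseteq> C" "\<forall>s\<in>I. w s \<in> S"
      "real n + (\<Sum>s\<in>I. \<Lambda> s (w s)) \<le> noise_weight * card (S \<inter> E) - merge_cost"
    using explainedE[OF C w] .
  show "\<exists>x n S. tour R x n S \<and> S \<subseteq> insert u C \<and> (\<forall>s\<in>I. v s \<in> S) \<and>
        real n + (\<Sum>s\<in>I. \<Lambda> s (v s)) \<le> noise_weight * card (S \<inter> E) - merge_cost"
  proof (cases "\<exists>s\<in>I. v s = u")
    case False
    then have "(\<Sum>s\<in>I. \<Lambda> s (v s)) = (\<Sum>s\<in>I. \<Lambda> s (w s))" "\<forall>s\<in>I. v s \<in> S"
      using S(3) by (auto simp: w_def intro!: sum.cong)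
    then show ?thesis
      using S by (intro exI[of _ a] exI[of _ n] exI[of _ S]) auto
  next
    case True
    then obtain s0 where s0: "s0 \<in> I" "v s0 = u" by blast
    have "y s0 \<in> S" "R u (y s0)"
      using S(3) y s0 by (auto simp: w_def)
    then have tour: "tour R u (n + 2) (insert u S)"
      using S(1) tour_rotate tour_extend R_sym by metis
    have card: "insert u S \<inter> E = S \<inter> E"
      using u by auto
    have le: "\<Lambda> s (v s) \<le> \<Lambda> s (w s)" if "s \<in> I" for s
      using y[OF that] by (auto simp: w_def)
    have "(\<Sum>s\<in>I. \<Lambda> s (v s)) + 2 = \<Lambda> s0 (v s0) + 2 + (\<Sum>s\<in>I - {s0}. \<Lambda> s (v s))"
      by (simp add: sum.remove[OF fin_I s0(1)])
    also have "\<dots> \<le> \<Lambda> s0 (w s0) + (\<Sum>s\<in>I - {s0}. \<Lambda> s (w s))"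
      using y[OF s0(1)] s0(2) le by (intro add_mono sum_mono) (auto simp: w_def)
    also have "\<dots> = (\<Sum>s\<in>I. \<Lambda> s (w s))"
      by (simp add: sum.remove[OF fin_I s0(1)])
    finally have "real (n + 2) + (\<Sum>s\<in>I. \<Lambda> s (v s)) \<le> noise_weight * card (insert u S \<inter> E) - merge_cost"
      using S(4) unfolding card by simp
    moreover have "\<forall>s\<in>I. v s \<in> insert u S"
      using S(3) by (auto simp: w_def split: if_splits)
    ultimately show ?thesis
      using tour S(2) by (intro exI[of _ u] exI[of _ "n + 2"] exI[of _ "insert u S"]) auto
  qed
qed

definition explained_partition :: "'v set \<Rightarrow> 'v set \<Rightarrow> 'v set set \<Rightarrow> bool" where
  "explained_partition E H P \<longleftrightarrow> \<Union>P = H \<and> disjoint P \<and> (\<forall>C\<in>P. explained E C)"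

text \<open>The points of \<open>Y\<close> are absorbed one by one; pairwise adjacency supplies the
  edge along which two classes are joined.\<close>

lemma explained_partition_merge:
  assumes "explained_partition E H P" "finite Y" "Y \<noteq> {}" "Y \<subseteq> H"
    and "\<And>x y. x \<in> Y \<Longrightarrow> y \<in> Y \<Longrightarrow> R x y"
  shows "\<exists>P' C. explained_partition E H P' \<and> C \<in> P' \<and> Y \<subseteq> C"
  using assms(2-)
proof (induction Y rule: finite_ne_induct)
  case (singleton x)
  then show ?case
    using assms(1) by (auto simp: explained_partition_def)
next
  case (insert x Y)
  then obtain P' C where P': "explained_partition E H P'" "C \<in> P'" "Y \<subseteq> C"
    by auto
  obtain D where D: "D \<in> P'" "x \<in> D"
    using insert.prems(1) P'(1) by (auto simp: explained_partition_def)
  obtain y where y: "y \<in> Y" using insert.hyps by blast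
  show ?case
  proof (cases "C = D")
    case True
    then show ?thesis using P' D by blast
  next
    case False
    let ?P = "insert (C \<union> D) (P' - {C, D})"
    have disj: "C \<inter> D = {}"
      using P' D False by (auto simp: explained_partition_def disjoint_def)
    have "explained E (C \<union> D)"
      using P' D disj y insert.prems(2)[of y x]
      by (intro explained_Un[of E C D y x]) (auto simp: explained_partition_def)
    moreover have "disjoint ?P"
      using P'(1,2) D(1) unfolding explained_partition_def disjoint_def by auto
    ultimately have "explained_partition E H ?P"
      using P' D unfolding explained_partition_def by auto
    then show ?thesis
      using P'(3) D(2) by blast
  qed
qed

lemma explained_partition_exists:
  fixes rank :: "'v \<Rightarrow> nat"
  assumes "finite H"
    and "\<And>u. u \<in> H \<Longrightarrow> u \<notin> E \<Longrightarrow> \<exists>y. (\<forall>s\<in>I. y s \<in> H \<and> R u (y s) \<and> \<Lambda> s u + 2 \<le> \<Lambda> s (y s) \<and> rank (y s) < rank u)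
           \<and> (\<forall>s\<in>I. \<forall>s'\<in>I. R (y s) (y s'))"
  shows "\<exists>P. explained_partition E H P"
  using assms
\<comment> \<open>Points are added in nondecreasing order of \<open>rank\<close>, so the
  predecessors of the new point and of all earlier points lie in the old set.\<close>
proof (induction H rule: finite_ranking_induct[where f = rank])
  case empty
  show ?case by (auto simp: explained_partition_def)
next
  case (insert u H)
  show ?case
  proof (cases "u \<in> H")
    case True
    then show ?thesis using insert by (simp add: insert_absorb)
  next
    case False
    have "\<exists>P. explained_partition E H P"
    proof (rule insert.IH)
      fix u' assume u': "u' \<in> H" "u' \<notin> E"
      then obtain y where y: "\<forall>s\<in>I. y s \<in> insert u H \<and> R u' (y s) \<and> \<Lambda> s u' + 2 \<le> \<Lambda> s (y s) \<and> rank (y s) < rank u'"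
          "\<forall>s\<in>I. \<forall>s'\<in>I. R (y s) (y s')"
        using insert.prems[of u'] by auto
      moreover have "rank u' \<le> rank u" using u' insert.hyps by auto
      ultimately have "\<forall>s\<in>I. y s \<in> H" by force
      then show "\<exists>y. (\<forall>s\<in>I. y s \<in> H \<and> R u' (y s) \<and> \<Lambda> s u' + 2 \<le> \<Lambda> s (y s) \<and> rank (y s) < rank u')
           \<and> (\<forall>s\<in>I. \<forall>s'\<in>I. R (y s) (y s'))"
        using y by blast
    qed
    then obtain P where P: "explained_partition E H P" ..
    show ?thesis
    proof (cases "u \<in> E")
      case True
      then have "explained_partition E (insert u H) (insert {u} P)"
        using P False explained_noise[OF True]
        by (auto simp: explained_partition_def disjoint_def)
      then show ?thesis ..
    next
      case nE: False
      obtain y where y: "\<forall>s\<in>I. y s \<in> insert u H \<and> R u (y s) \<and> \<Lambda> s u + 2 \<le> \<Lambda> s (y s) \<and> rank (y s) < rank u"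
          "\<forall>s\<in>I. \<forall>s'\<in>I. R (y s) (y s')"
        using insert.prems[of u] nE by auto
      then have "y ` I \<subseteq> H" by force
      then have "\<exists>P' C. explained_partition E H P' \<and> C \<in> P' \<and> y ` I \<subseteq> C"
        using fin_I ne_I y(2) by (intro explained_partition_merge[OF P]) auto
      then obtain P' C where P': "explained_partition E H P'" "C \<in> P'" "y ` I \<subseteq> C"
        by blast
      have "u \<notin> C" using P' False by (auto simp: explained_partition_def)
      then have "explained E (insert u C)"
        using P' y nE by (intro explained_insert[of E C u y]) (auto simp: explained_partition_def)
      moreover have "disjoint (insert (insert u C) (P' - {C}))"
      proof -
        have "A \<inter> B = {}" if "A \<in> P'" "B \<in> P'" "A \<noteq> B" for A B
          using P'(1) that by (auto simp: explained_partition_def disjoint_def)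
        moreover have "u \<notin> B" if "B \<in> P'" for B
          using P'(1) False that by (auto simp: explained_partition_def)
        ultimately show ?thesis
          using P'(2) unfolding disjoint_def by (simp add: Int_commute)
      qed
      ultimately have "explained_partition E (insert u H) (insert (insert u C) (P' - {C}))"
        using P' unfolding explained_partition_def by auto
      then show ?thesis ..
    qed
  qed
qed

text \<open>Put all poles at \<open>z\<close>. The saved credit exceeds \<open>c\<^sub>0\<close> and
  so outweighs the functionals. The resulting strict inequality forces the walk to meet
  \<open>E\<close>.\<close>

lemma explanation_tour:
  fixes rank :: "'v \<Rightarrow> nat"
  assumes "finite H" "z \<in> H"
    and "\<And>u. u \<in> H \<Longrightarrow> u \<notin> E \<Longrightarrow> \<exists>y. (\<forall>s\<in>I. y s \<in> H \<and> R u (y s) \<and> \<Lambda> s u + 2 \<le> \<Lambda> s (y s) \<and> rank (y s) < rank u)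
           \<and> (\<forall>s\<in>I. \<forall>s'\<in>I. R (y s) (y s'))"
  obtains n S where "tour R z n S" "S \<subseteq> H" "real n < noise_weight * card (S \<inter> E)"
proof -
  obtain P where P: "explained_partition E H P"
    using explained_partition_exists[OF assms(1,3)] by blast
  then obtain C where C: "C \<in> P" "z \<in> C"
    using assms(2) by (auto simp: explained_partition_def)
  then have CH: "C \<subseteq> H" "explained E C"
    using P by (auto simp: explained_partition_def)
  obtain x n S where S: "tour R x n S" "S \<subseteq> C" "\<forall>s\<in>I. z \<in> S"
      "real n + (\<Sum>s\<in>I. \<Lambda> s z) \<le> noise_weight * card (S \<inter> E) - merge_cost"
    using explainedE[OF CH(2), of "\<lambda>_. z"] C(2) by blast
  have "real n < noise_weight * card (S \<inter> E)"
    using S(4) sum_bound[of z] merge_cost_def c_nonneg by linarith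
  then show ?thesis
    using that[of n S] S CH(1) ne_I tour_rotate by (metis equals0I order_trans)
qed

end

section \<open>Counting walks\<close>

definition walks :: "('v \<Rightarrow> 'v \<Rightarrow> bool) \<Rightarrow> 'v \<Rightarrow> nat \<Rightarrow> 'v list set" where
  "walks R z n = {ws. length ws = n \<and> successively R (z # ws)}"

lemma card_walks_le:
  assumes "\<And>u. finite {v. R u v}" "\<And>u. card {v. R u v} \<le> D"
  shows "finite (walks R z n) \<and> card (walks R z n) \<le> D ^ n"
proof (induction n arbitrary: z)
  case 0
  have "walks R z 0 = {[]}" by (auto simp: walks_def)
  then show ?case by simp
next
  case (Suc n)
  have eq: "walks R z (Suc n) = (\<Union>v\<in>{v. R z v}. (#) v ` walks R v n)"
    by (auto simp: walks_def length_Suc_conv image_iff)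
  have "card (walks R z (Suc n)) \<le> (\<Sum>v\<in>{v. R z v}. card ((#) v ` walks R v n))"
    unfolding eq by (rule card_UN_le[OF assms(1)])
  also have "\<dots> \<le> (\<Sum>v\<in>{v. R z v}. D ^ n)"
    using Suc.IH card_image_le le_trans by (intro sum_mono) blast
  also have "\<dots> \<le> D ^ Suc n"
    using assms(2)[of z] by simp
  finally show ?case
    using Suc.IH assms(1) unfolding eq by auto
qed

text \<open>Waiting at \<open>z\<close> fills up the length, so that walks of one length per number
  of noise points suffice in the union bound.\<close>

lemma tour_walk_padded:
  assumes "tour R z n S" "R z z" "n \<le> m"
  obtains ws where "ws \<in> walks R z m" "set (z # ws) = S"
proof -
  obtain ws where ws: "length ws = n" "successively R (z # ws)" "last (z # ws) = z" "set (z # ws) = S"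
    using assms(1) by (auto simp: tour_def)
  have "successively R (replicate k z)" for k
    using assms(2) by (simp add: successively_conv_nth)
  moreover have "m - n = 0 \<or> hd (replicate (m - n) z) = z"
    by (cases "m - n") auto
  ultimately have "successively R ((z # ws) @ replicate (m - n) z)"
    using ws(2,3) assms(2) unfolding successively_append_iff by auto
  then have "ws @ replicate (m - n) z \<in> walks R z m" "set (z # ws @ replicate (m - n) z) = S"
    using ws assms(3) by (auto simp: walks_def)
  then show ?thesis using that by blast
qed

lemma geometric_tail_le:
  fixes \<rho> :: real
  assumes "0 \<le> \<rho>" "\<rho> \<le> 1/2"
  shows "(\<Sum>k=1..m. \<rho> ^ k) \<le> 2 * \<rho>"
proof -
  have "(\<Sum>k=1..m. \<rho> ^ k) \<le> 2 * \<rho> * (1 - (1/2) ^ m)"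
  proof (induction m)
    case (Suc m)
    have "\<rho> ^ Suc m \<le> \<rho> * (1/2) ^ m"
      using assms by (simp add: mult_left_mono power_mono)
    then show ?case using Suc by (simp add: algebra_simps)
  qed simp
  also have "\<dots> \<le> 2 * \<rho> * 1"
    using assms by (intro mult_left_mono) auto
  finally show ?thesis by simp
qed

text \<open>Union bound over the number \<open>k\<close> of noise points, the walks of length
  \<open>K * k\<close> and the \<open>k\<close>-element sets of their vertices: at most
  \<open>D ^ (K * k)\<close> walks and \<open>2 ^ (K * k + 1)\<close> sets each, of probability at
  most \<open>q ^ k\<close>. The geometric series gives a bound that does not depend on
  \<open>V\<close>, hence not on the time.\<close>

lemma (in prob_space) peierls_bound:
  fixes E :: "'a \<Rightarrow> 'v set" and q :: real and K D :: nat
  assumes deg: "\<And>u. finite {v. R u v}" "\<And>u. card {v. R u v} \<le> D" and refl: "R z z"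
    and V: "finite V"
    and meas: "\<And>v. v \<in> V \<Longrightarrow> {\<omega> \<in> space M. v \<in> E \<omega>} \<in> events"
    and q: "0 \<le> q" "\<And>T. T \<subseteq> V \<Longrightarrow> prob {\<omega> \<in> space M. T \<subseteq> E \<omega>} \<le> q ^ card T"
    and small: "(2 * real D) ^ K * q \<le> 1/2"
    and A: "A \<subseteq> space M" "\<And>\<omega>. \<omega> \<in> A \<Longrightarrow> \<exists>n S. tour R z n S \<and> S \<subseteq> V \<and> S \<inter> E \<omega> \<noteq> {} \<and> n \<le> K * card (S \<inter> E \<omega>)"
  shows "prob A \<le> 4 * ((2 * real D) ^ K * q)"
proof -
  define \<rho> where "\<rho> = (2 * real D) ^ K * q"
  define Ts where "Ts ws k = {T. T \<subseteq> set (z # ws) \<inter> V \<and> card T = k}" for ws k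
  define Ev where "Ev T = {\<omega> \<in> space M. T \<subseteq> E \<omega>}" for T
  define W where "W k = (\<Union>ws\<in>walks R z (K * k). \<Union>T\<in>Ts ws k. Ev T)" for k
  have \<rho>: "0 \<le> \<rho>" "\<rho> \<le> 1/2"
    using q(1) small by (auto simp: \<rho>_def)
  have fin_walks: "finite (walks R z n)" and card_walks: "card (walks R z n) \<le> D ^ n" for n
    using card_walks_le[of R D, OF deg] by blast+
  have fin_Ts: "finite (Ts ws k)" for ws k
    using V by (auto simp: Ts_def)
  have Ev_meas: "Ev T \<in> events" if "T \<in> Ts ws k" for T ws k
  proof -
    have "T \<subseteq> V" "finite T" using that V by (auto simp: Ts_def intro: finite_subset)
    moreover have "Ev T = {\<omega> \<in> space M. \<forall>v\<in>T. \<omega> \<in> {\<omega> \<in> space M. v \<in> E \<omega>}}"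
      by (auto simp: Ev_def)
    ultimately show ?thesis
      using meas by (auto intro!: sets.sets_Collect_finite_All)
  qed
  have Ts_prob: "prob (\<Union>T\<in>Ts ws k. Ev T) \<le> 2 ^ (K * k + 1) * q ^ k"
    if ws: "ws \<in> walks R z (K * k)" for ws k
  proof -
    have "prob (\<Union>T\<in>Ts ws k. Ev T) \<le> (\<Sum>T\<in>Ts ws k. prob (Ev T))"
      using fin_Ts Ev_meas by (intro finite_measure_subadditive_finite) auto
    also have "\<dots> \<le> (\<Sum>T\<in>Ts ws k. q ^ k)"
      using q(2) by (intro sum_mono) (auto simp: Ts_def Ev_def)
    also have "\<dots> = card (Ts ws k) * q ^ k" by simp
    also have "card (Ts ws k) \<le> card (Pow (set (z # ws)))"
      by (intro card_mono) (auto simp: Ts_def)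
    also have "\<dots> = 2 ^ card (set (z # ws))"
      by (simp add: card_Pow)
    also have "\<dots> \<le> 2 ^ (K * k + 1)"
      using ws card_length[of "z # ws"] by (intro power_increasing) (auto simp: walks_def)
    finally show ?thesis
      using q(1) by (simp add: mult_right_mono)
  qed
  have W_meas: "W k \<in> events" for k
    unfolding W_def using fin_walks fin_Ts Ev_meas by (intro sets.finite_UN) auto
  have W_prob: "prob (W k) \<le> 2 * \<rho> ^ k" for k
  proof -
    have "prob (W k) \<le> (\<Sum>ws\<in>walks R z (K * k). prob (\<Union>T\<in>Ts ws k. Ev T))"
      unfolding W_def using fin_walks fin_Ts Ev_meas
      by (intro finite_measure_subadditive_finite) auto
    also have "\<dots> \<le> card (walks R z (K * k)) * (2 ^ (K * k + 1) * q ^ k)"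
      by (rule sum_bounded_above) (rule Ts_prob)
    also have "\<dots> \<le> real (D ^ (K * k)) * (2 ^ (K * k + 1) * q ^ k)"
      using card_walks q(1) by (intro mult_right_mono) (auto simp del: of_nat_power)
    also have "\<dots> = 2 * \<rho> ^ k"
      by (simp add: \<rho>_def power_mult_distrib power_mult)
    finally show ?thesis .
  qed
  have "A \<subseteq> (\<Union>k\<in>{1..card V}. W k)"
  proof
    fix \<omega> assume \<omega>: "\<omega> \<in> A"
    obtain n S where S: "tour R z n S" "S \<subseteq> V" "S \<inter> E \<omega> \<noteq> {}" "n \<le> K * card (S \<inter> E \<omega>)"
      using A(2)[OF \<omega>] by blast
    obtain ws where ws: "ws \<in> walks R z (K * card (S \<inter> E \<omega>))" "set (z # ws) = S"
      using tour_walk_padded[of R z n S, OF S(1) refl S(4)] by blast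
    have "S \<inter> E \<omega> \<in> Ts ws (card (S \<inter> E \<omega>))" "\<omega> \<in> Ev (S \<inter> E \<omega>)"
      using S(2) \<omega> A(1) unfolding Ts_def Ev_def ws(2) by blast+
    then have "\<omega> \<in> W (card (S \<inter> E \<omega>))"
      using ws(1) by (auto simp: W_def)
    moreover have "card (S \<inter> E \<omega>) \<in> {1..card V}"
    proof -
      have "finite S" using S(2) V finite_subset by blast
      moreover have "card (S \<inter> E \<omega>) \<le> card V"
        using S(2) V by (intro card_mono) auto
      ultimately show ?thesis
        using S(3) by (simp add: Suc_le_eq card_gt_0_iff)
    qed
    ultimately show "\<omega> \<in> (\<Union>k\<in>{1..card V}. W k)" by blast
  qed
  then have "prob A \<le> prob (\<Union>k\<in>{1..card V}. W k)"
    using W_meas by (intro finite_measure_mono) auto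
  also have "\<dots> \<le> (\<Sum>k=1..card V. prob (W k))"
    using W_meas by (intro finite_measure_subadditive_finite) auto
  also have "\<dots> \<le> (\<Sum>k=1..card V. 2 * \<rho> ^ k)"
    using W_prob by (intro sum_mono)
  also have "\<dots> \<le> 4 * \<rho>"
    using geometric_tail_le[OF \<rho>, of "card V"] by (simp add: sum_distrib_left[symmetric])
  finally show ?thesis by (simp add: \<rho>_def)
qed

section \<open>Error probability of the automata\<close>

lemma shift_shift:
  "L > 0 \<Longrightarrow> shift L (shift L r a b) a' b' = shift L r (a + a') (b + b')"
  by (simp add: shift_def mod_add_left_eq add.assoc)

lemma shift_in_torus: "L > 0 \<Longrightarrow> shift L r a b \<in> torus L"
  by (simp add: shift_def torus_def nat_less_iff)

lemma shift_zero: "r \<in> torus L \<Longrightarrow> shift L r 0 0 = r"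
  by (cases r) (auto simp: shift_def torus_def)

lemma int_eq_if_mod_eq:
  fixes a b n :: int
  assumes "(k + a) mod n = (k + b) mod n" "\<bar>a - b\<bar> < n"
  shows "a = b"
proof -
  have "n dvd (a - b)"
    using assms(1) by (simp add: mod_eq_dvd_iff)
  then show ?thesis
    using assms(2) dvd_imp_le_int[of "a - b" n] by force
qed

lemma shift_eq_iff:
  assumes "L > 0" "\<bar>a - a'\<bar> < int L" "\<bar>b - b'\<bar> < int L"
  shows "shift L r a b = shift L r a' b' \<longleftrightarrow> a = a' \<and> b = b'"
proof
  assume "shift L r a b = shift L r a' b'"
  then have "(int (fst r) + a) mod int L = (int (fst r) + a') mod int L"
      "(int (snd r) + b) mod int L = (int (snd r) + b') mod int L"
    using assms(1) by (auto simp: shift_def nat_eq_iff)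
  then show "a = a' \<and> b = b'"
    using assms int_eq_if_mod_eq by blast
qed auto

section \<open>Neighbourhoods and the backward propagation of errors\<close>

fun nbhd :: "CA \<Rightarrow> nat \<Rightarrow> (int \<times> int) set" where
  "nbhd CA_R t = (if even t then {(0,1), (0,0), (0,-1)} else {(1,0), (0,0), (-1,0)})"
| "nbhd CA_F t = (if even t then {(1,0), (-1,-1)} else {(1,1), (0,-1)})"
| "nbhd CA_M t = (if even t then {(1,0), (0,1)} else {(1,0), (0,-1)})"
| "nbhd CA_T t = {(0,0), (1,0), (0,-1)}"

text \<open>The steps in which an error, absent noise, needs errors on the whole neighbourhood: disjunctions
  when errors are \<open>False\<close>, conjunctions when errors are \<open>True\<close>. In all other steps one
  error in the neighbourhood suffices.\<close>

definition unanimous :: "CA \<Rightarrow> bool \<Rightarrow> nat \<Rightarrow> bool" where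
  "unanimous A b t \<longleftrightarrow> b = (if A = CA_R then odd t else even t)"

lemma nbhd_bounded: "d \<in> nbhd A t \<Longrightarrow> \<bar>fst d\<bar> \<le> 1 \<and> \<bar>snd d\<bar> \<le> 1"
  by (cases A) (auto split: if_splits)

lemma rule_error:
  assumes "r \<in> torus L" "rule A L t s r \<noteq> b"
  shows "if unanimous A b t then \<forall>d\<in>nbhd A t. s (shift L r (fst d) (snd d)) \<noteq> b
         else \<exists>d\<in>nbhd A t. s (shift L r (fst d) (snd d)) \<noteq> b"
  using assms shift_zero[OF assms(1)] by (cases A; cases b) (auto simp: unanimous_def split: if_splits)

lemma rule_cong:
  assumes "r \<in> torus L" "\<And>d. d \<in> nbhd A t \<Longrightarrow> s (shift L r (fst d) (snd d)) = s' (shift L r (fst d) (snd d))"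
  shows "rule A L t s r = rule A L t s' r"
proof -
  note eqs = assms(2)[of "(0,0)"] assms(2)[of "(1,0)"] assms(2)[of "(-1,0)"] assms(2)[of "(0,1)"]
    assms(2)[of "(0,-1)"] assms(2)[of "(1,1)"] assms(2)[of "(-1,-1)"]
  show ?thesis
    using eqs shift_zero[OF assms(1)] by (cases A; cases "even t") simp_all
qed

text \<open>The linear functionals do not live on the torus, so the past cone of a site is unrolled: node
  \<open>(t, x, y)\<close> stands for the site at displacement \<open>(x, y)\<close> at time \<open>t\<close>. This
  is injective on the cone as soon as \<open>L\<close> exceeds twice its height.\<close>

type_synonym node = "nat \<times> int \<times> int"

text \<open>Spatial distance 2 is allowed because two predecessors of one node, which must be
  adjacent for their classes to merge, can differ by 2 in a coordinate.\<close>

definition near :: "node \<Rightarrow> node \<Rightarrow> bool" where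
  "near = (\<lambda>(t, x, y) (t', x', y'). \<bar>int t - int t'\<bar> \<le> 1 \<and> \<bar>x - x'\<bar> \<le> 2 \<and> \<bar>y - y'\<bar> \<le> 2)"

lemma near_refl: "near u u"
  by (auto simp: near_def)

lemma near_degree: "finite {v. near u v}" "card {v. near u v} \<le> 75"
proof -
  obtain t x y where u: "u = (t, x, y)" by (cases u)
  let ?B = "{t - 1..t + 1} \<times> {x - 2..x + 2} \<times> {y - 2..y + 2}"
  have sub: "{v. near u v} \<subseteq> ?B"
    by (auto simp: near_def u)
  then show "finite {v. near u v}"
    by (rule finite_subset) auto
  have "card {v. near u v} \<le> card ?B"
    using sub by (intro card_mono) auto
  also have "\<dots> = card {t - 1..t + 1} * 25"
    by (simp add: card_cartesian_product)
  also have "\<dots> \<le> 75" by simp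
  finally show "card {v. near u v} \<le> 75" .
qed

definition cone :: "nat \<Rightarrow> node set" where
  "cone n = {(t, x, y). t \<le> n \<and> \<bar>x\<bar> \<le> int n - int t \<and> \<bar>y\<bar> \<le> int n - int t}"

lemma finite_cone: "finite (cone n)"
  by (rule finite_subset[of _ "{..n} \<times> {-int n..int n} \<times> {-int n..int n}"]) (auto simp: cone_def)

text \<open>The spin at time \<open>t\<close> is produced with the noise variable of time \<open>t - 1\<close>, and
  there is none at time \<open>0\<close>.\<close>

definition noise_nodes :: "nat \<Rightarrow> site \<Rightarrow> bool \<Rightarrow> noise \<Rightarrow> node set" where
  "noise_nodes L r b w = {(t, x, y). t > 0 \<and> w (t - 1, shift L r x y) = Some (\<not> b)}"

locale Toom_certificate = Toom_functionals near "{..<3::nat}" \<Lambda> c\<^sub>0 c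
  for \<Lambda> :: "nat \<Rightarrow> node \<Rightarrow> real" and c\<^sub>0 c :: real +
  fixes A :: CA and b :: bool
  assumes gain_unanimous: "unanimous A b t \<Longrightarrow> s < 3 \<Longrightarrow>
      \<exists>d\<in>nbhd A t. \<Lambda> s (Suc t, x, y) + 2 \<le> \<Lambda> s (t, x + fst d, y + snd d)"
    and gain_any: "\<not> unanimous A b t \<Longrightarrow> s < 3 \<Longrightarrow> d \<in> nbhd A t \<Longrightarrow>
      \<Lambda> s (Suc t, x, y) + 2 \<le> \<Lambda> s (t, x + fst d, y + snd d)"
begin

definition K :: nat where "K = nat \<lceil>noise_weight\<rceil>"

text \<open>Apply \<open>explanation_tour\<close> to the error nodes of the cone, ranked by
  time.\<close>

lemma error_tour:
  assumes L: "L > 0" and r: "r \<in> torus L" and err: "evolve A L w n (\<lambda>_. b) r \<noteq> b"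
  shows "\<exists>m S. tour near (n, 0, 0) m S \<and> S \<subseteq> cone n \<and> S \<inter> noise_nodes L r b w \<noteq> {} \<and>
           m \<le> K * card (S \<inter> noise_nodes L r b w)"
proof -
  define H where "H = {(t, x, y). (t, x, y) \<in> cone n \<and> evolve A L w t (\<lambda>_. b) (shift L r x y) \<noteq> b}"
  define E where "E = noise_nodes L r b w"
  have "finite H"
    by (rule finite_subset[OF _ finite_cone[of n]]) (auto simp: H_def)
  moreover have "(n, 0, 0) \<in> H"
    using err shift_zero[OF r] by (auto simp: H_def cone_def)
  moreover have "\<exists>y. (\<forall>s\<in>{..<3}. y s \<in> H \<and> near u (y s) \<and> \<Lambda> s u + 2 \<le> \<Lambda> s (y s) \<and> fst (y s) < fst u)
           \<and> (\<forall>s\<in>{..<3}. \<forall>s'\<in>{..<3}. near (y s) (y s'))"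
    if u: "u \<in> H" "u \<notin> E" for u
  proof -
    obtain t x y where uq: "u = (t, x, y)" by (cases u)
    \<comment> \<open>No error has time 0, because the evolution starts from the constant
      \<open>b\<close>.\<close>
    obtain t' where t': "t = Suc t'"
      using u by (cases t) (auto simp: uq H_def)
    define R where "R = shift L r x y"
    have "rule A L t' (evolve A L w t' (\<lambda>_. b)) R \<noteq> b"
      using u by (auto simp: uq t' H_def E_def noise_nodes_def R_def split: option.splits)
    then have re: "if unanimous A b t'
         then \<forall>d\<in>nbhd A t'. evolve A L w t' (\<lambda>_. b) (shift L R (fst d) (snd d)) \<noteq> b
         else \<exists>d\<in>nbhd A t'. evolve A L w t' (\<lambda>_. b) (shift L R (fst d) (snd d)) \<noteq> b"
      using shift_in_torus[OF L] by (intro rule_error) (auto simp: R_def)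
    have H: "(t', x + fst d, y + snd d) \<in> H"
      if "d \<in> nbhd A t'" "evolve A L w t' (\<lambda>_. b) (shift L R (fst d) (snd d)) \<noteq> b" for d
      using u(1) that nbhd_bounded[OF that(1)] L
      by (auto simp: H_def R_def uq t' shift_shift cone_def)
    have "\<exists>d. \<forall>s<3. d s \<in> nbhd A t' \<and> (t', x + fst (d s), y + snd (d s)) \<in> H \<and>
        \<Lambda> s u + 2 \<le> \<Lambda> s (t', x + fst (d s), y + snd (d s))"
    \<comment> \<open>In a unanimous step all neighbours are errors and each functional picks its
      own; otherwise one error neighbour serves all three.\<close>
    proof (cases "unanimous A b t'")
      case True
      then have "\<forall>s. \<exists>d. s < 3 \<longrightarrow> d \<in> nbhd A t' \<and> \<Lambda> s u + 2 \<le> \<Lambda> s (t', x + fst d, y + snd d)"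
        using gain_unanimous unfolding uq t' by blast
      then obtain d where "\<forall>s. s < 3 \<longrightarrow> d s \<in> nbhd A t' \<and> \<Lambda> s u + 2 \<le> \<Lambda> s (t', x + fst (d s), y + snd (d s))"
        by metis
      then show ?thesis
        using True re H by (intro exI[of _ d]) auto
    next
      case False
      then obtain d where "d \<in> nbhd A t'" "evolve A L w t' (\<lambda>_. b) (shift L R (fst d) (snd d)) \<noteq> b"
        using re by auto
      then show ?thesis
        using False H gain_any unfolding uq t' by (intro exI[of _ "\<lambda>_. d"]) auto
    qed
    then obtain d where d: "\<And>s. s < 3 \<Longrightarrow> d s \<in> nbhd A t' \<and> (t', x + fst (d s), y + snd (d s)) \<in> H \<and>
        \<Lambda> s u + 2 \<le> \<Lambda> s (t', x + fst (d s), y + snd (d s))"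
      by blast
    have bd: "\<bar>fst (d s)\<bar> \<le> 1" "\<bar>snd (d s)\<bar> \<le> 1" if "s < 3" for s
      using nbhd_bounded d[OF that] by blast+
    have nr: "near u (t', x + fst (d s), y + snd (d s))" if "s < 3" for s
      using bd[OF that] by (auto simp: near_def uq t')
    have nr': "near (t', x + fst (d s), y + snd (d s)) (t', x + fst (d s'), y + snd (d s'))"
      if "s < 3" "s' < 3" for s s'
      using bd[OF that(1)] bd[OF that(2)] by (auto simp: near_def)
    show ?thesis
      using d nr nr' by (intro exI[of _ "\<lambda>s. (t', x + fst (d s), y + snd (d s))"]) (auto simp: uq t')
  qed
  ultimately obtain m S where S: "tour near (n, 0, 0) m S" "S \<subseteq> H" "real m < noise_weight * card (S \<inter> E)"
    using explanation_tour[of H "(n, 0, 0)" E fst] by blast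
  have "S \<inter> E \<noteq> {}"
    using S(3) by auto
  moreover have "m \<le> K * card (S \<inter> E)"
  proof -
    have "noise_weight \<le> real K"
      unfolding K_def by linarith
    then have "noise_weight * card (S \<inter> E) \<le> real K * card (S \<inter> E)"
      by (intro mult_right_mono) auto
    then have "real m \<le> real (K * card (S \<inter> E))"
      using S(3) by simp
    then show ?thesis by linarith
  qed
  moreover have "S \<subseteq> cone n"
    using S(2) by (auto simp: H_def)
  ultimately show ?thesis
    using S(1) unfolding E_def by blast
qed

end

section \<open>The product measure of the noise\<close>

lemma product_prob_space_noise: "product_prob_space (\<lambda>_. measure_pmf (noise_pmf p \<eta>))"
  by unfold_locales

lemma prob_space_noise_space: "prob_space (noise_space p \<eta>)"
proof -
  interpret product_prob_space "\<lambda>_. measure_pmf (noise_pmf p \<eta>)" UNIV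
    by (rule product_prob_space_noise)
  show ?thesis unfolding noise_space_def by (rule P.prob_space_axioms)
qed

lemma space_noise_space [simp]: "space (noise_space p \<eta>) = UNIV"
  by (simp add: noise_space_def space_PiM)

lemma pmf_noise_le:
  assumes "0 \<le> p" "p \<le> 1"
  shows "pmf (noise_pmf p \<eta>) (Some v) \<le> p"
proof -
  have "pmf (noise_pmf p \<eta>) (Some v) = p * pmf (map_pmf Some (bernoulli_pmf ((1 + \<eta>) / 2))) (Some v)"
    using assms unfolding noise_pmf_def by (simp add: pmf_bind)
  also have "\<dots> \<le> p * 1"
    using assms by (intro mult_left_mono) (auto simp: pmf_le_1)
  finally show ?thesis by simp
qed

lemma noise_coordinate_measurable [measurable]:
  "(\<lambda>w. w j) \<in> measurable (PiM J (\<lambda>_. measure_pmf N)) (count_space UNIV)"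
proof (cases "j \<in> J")
  case True
  then have "(\<lambda>w. w j) \<in> measurable (PiM J (\<lambda>_. measure_pmf N)) (measure_pmf N)"
    by (rule measurable_component_singleton)
  then show ?thesis by (simp cong: measurable_cong_sets)
next
  \<comment> \<open>Outside \<open>J\<close> the coordinate of every point of the product is
    \<open>undefined\<close>, hence constant.\<close>
  case False
  have "w j = undefined" if "w \<in> space (PiM J (\<lambda>_. measure_pmf N))" for w
    using that PiE_arb[OF _ False] unfolding space_PiM by blast
  then show ?thesis
    by (subst measurable_cong[where g = "\<lambda>_. undefined"]) auto
qed

lemma noise_nodes_measurable: "{w \<in> space (noise_space p \<eta>). v \<in> noise_nodes L r b w} \<in> sets (noise_space p \<eta>)"
proof -
  obtain t x y where v: "v = (t, x, y)" by (cases v)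
  show ?thesis
    unfolding v noise_nodes_def noise_space_def by measurable
qed

text \<open>As \<open>2 * n < L\<close>, distinct nodes of positive time in the cone use distinct
  noise variables, so the probability factorizes.\<close>

lemma prob_noise_nodes_le:
  assumes p: "0 \<le> p" "p \<le> 1" and L: "2 * n < L" and T: "T \<subseteq> cone n"
  shows "measure (noise_space p \<eta>) {w \<in> space (noise_space p \<eta>). T \<subseteq> noise_nodes L r b w} \<le> p ^ card T"
\<comment> \<open>Nodes at time 0 are never noise. They are set apart because truncated
  \<open>t - 1\<close> identifies times 0 and 1 and would spoil injectivity of
  \<open>\<phi>\<close>.\<close>
proof (cases "\<exists>v\<in>T. fst v = 0")
  case True
  then have "{w \<in> space (noise_space p \<eta>). T \<subseteq> noise_nodes L r b w} = {}"
    by (force simp: noise_nodes_def)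
  then show ?thesis using p(1) by simp
next
  case False
  define \<phi> where "\<phi> = (\<lambda>(t, x, y). (t - 1 :: nat, shift L r x y))"
  have fin: "finite T" using T finite_cone finite_subset by blast
  have inj: "inj_on \<phi> T"
  proof (rule inj_onI)
    fix u v assume uv: "u \<in> T" "v \<in> T" "\<phi> u = \<phi> v"
    obtain t x y t' x' y' where q: "u = (t, x, y)" "v = (t', x', y')" by (cases u, cases v)
    have "\<bar>x\<bar> \<le> int n" "\<bar>y\<bar> \<le> int n" "\<bar>x'\<bar> \<le> int n" "\<bar>y'\<bar> \<le> int n"
      using T uv q by (auto simp: cone_def)
    moreover have "shift L r x y = shift L r x' y'" using uv(3) by (simp add: \<phi>_def q)
    ultimately have "x = x' \<and> y = y'"
      using L by (subst (asm) shift_eq_iff) auto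
    moreover have "t > 0" "t' > 0" "t - 1 = t' - 1"
      using uv False by (auto simp: q \<phi>_def)
    ultimately show "u = v" by (simp add: q)
  qed
  interpret product_prob_space "\<lambda>_. measure_pmf (noise_pmf p \<eta>)" UNIV
    by (rule product_prob_space_noise)
  interpret N: prob_space "noise_space p \<eta>" by (rule prob_space_noise_space)
  let ?N = "measure_pmf (noise_pmf p \<eta>)"
  have "{w \<in> space (noise_space p \<eta>). T \<subseteq> noise_nodes L r b w}
      = {w \<in> space (PiM UNIV (\<lambda>_. ?N)). \<forall>j\<in>\<phi> ` T. w j \<in> {Some (\<not> b)}}"
    using False by (force simp: noise_nodes_def \<phi>_def space_PiM)
  then have "emeasure (noise_space p \<eta>) {w \<in> space (noise_space p \<eta>). T \<subseteq> noise_nodes L r b w}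
      = (\<Prod>j\<in>\<phi> ` T. emeasure ?N {Some (\<not> b)})"
    unfolding noise_space_def using fin by (subst emeasure_PiM_Collect[symmetric]) auto
  also have "\<dots> = ennreal (pmf (noise_pmf p \<eta>) (Some (\<not> b)) ^ card T)"
    by (simp add: card_image[OF inj] emeasure_pmf_single ennreal_power)
  finally have "measure (noise_space p \<eta>) {w \<in> space (noise_space p \<eta>). T \<subseteq> noise_nodes L r b w}
      = pmf (noise_pmf p \<eta>) (Some (\<not> b)) ^ card T"
    unfolding N.emeasure_eq_measure by simp
  then show ?thesis
    using pmf_noise_le[OF p] by (simp add: power_mono)
qed

text \<open>The base 150 is twice the degree bound 75 of \<open>near\<close>.\<close>

lemma (in Toom_certificate) prob_error_le:
  assumes p: "0 \<le> p" "p \<le> 1" and small: "150 ^ K * p \<le> 1/2" and L: "2 * n < L" and r: "r \<in> torus L"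
  shows "measure (noise_space p \<eta>) {w \<in> space (noise_space p \<eta>). evolve A L w n (\<lambda>_. b) r \<noteq> b} \<le> 4 * (150 ^ K * p)"
proof -
  interpret N: prob_space "noise_space p \<eta>" by (rule prob_space_noise_space)
  have "measure (noise_space p \<eta>) {w \<in> space (noise_space p \<eta>). evolve A L w n (\<lambda>_. b) r \<noteq> b}
      \<le> 4 * ((2 * real 75) ^ K * p)"
  proof (rule N.peierls_bound[where R = near and z = "(n, 0, 0)" and V = "cone n" and E = "noise_nodes L r b"])
    show "\<exists>m S. tour near (n, 0, 0) m S \<and> S \<subseteq> cone n \<and> S \<inter> noise_nodes L r b w \<noteq> {} \<and>
           m \<le> K * card (S \<inter> noise_nodes L r b w)"
      if "w \<in> {w \<in> space (noise_space p \<eta>). evolve A L w n (\<lambda>_. b) r \<noteq> b}" for w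
      using that L r by (intro error_tour) auto
  qed (use near_degree near_refl finite_cone noise_nodes_measurable p small prob_noise_nodes_le[OF p L] in auto)
  then show ?thesis by simp
qed

section \<open>Linear functionals witnessing erosion\<close>

lemma alternating_sum_bounded:
  fixes \<kappa> :: real
  shows "\<bar>\<Sum>i<t. if unanimous A b i then \<kappa> else - \<kappa>\<bar> \<le> \<bar>\<kappa>\<bar>"
proof -
  have "(\<Sum>i<t. if unanimous A b i then \<kappa> else - \<kappa>)
      = (if even t then 0 else if unanimous A b 0 then \<kappa> else - \<kappa>)"
    by (induction t) (auto simp: unanimous_def)
  then show ?thesis by auto
qed

text \<open>Here \<open>(\<alpha> s, \<beta> s)\<close> are directions in the plane; \<open>M s\<close> is the best displacement
  available in direction \<open>s\<close> in a unanimous step and \<open>m s\<close> the worst one in any other step.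
  A positive sum of all \<open>M s + m s\<close> says that the polygon with these normals, filled with
  errors, shrinks; it is normalised to 12 so that a time-dependent correction gives each of the three
  functionals a gain of 2 per step.\<close>

lemma Toom_certificateI:
  fixes \<alpha> \<beta> M m :: "nat \<Rightarrow> real"
  assumes sum0: "(\<Sum>s<3. \<alpha> s) = 0" "(\<Sum>s<3. \<beta> s) = 0"
    and drift: "(\<Sum>s<3. M s) + (\<Sum>s<3. m s) = 12"
    and M: "\<And>t s. unanimous A b t \<Longrightarrow> s < 3 \<Longrightarrow> \<exists>d\<in>nbhd A t. M s \<le> \<alpha> s * real_of_int (fst d) + \<beta> s * real_of_int (snd d)"
    and m: "\<And>t s d. \<not> unanimous A b t \<Longrightarrow> s < 3 \<Longrightarrow> d \<in> nbhd A t \<Longrightarrow> m s \<le> \<alpha> s * real_of_int (fst d) + \<beta> s * real_of_int (snd d)"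
  shows "\<exists>\<Lambda> c\<^sub>0 c. Toom_certificate \<Lambda> c\<^sub>0 c A b"
proof -
  \<comment> \<open>This correction offsets the guaranteed advance in direction \<open>s\<close>, so
    that every step is left with a gain of at least 2.\<close>
  define \<theta> where "\<theta> s t = (\<Sum>i<t. (if unanimous A b i then M s else m s) - 2)" for s and t :: nat
  define \<Lambda> :: "nat \<Rightarrow> node \<Rightarrow> real" where "\<Lambda> s = (\<lambda>(t, x, y). \<alpha> s * x + \<beta> s * y + \<theta> s t)" for s
  \<comment> \<open>The three corrections add up to \<open>\<kappa>\<close> in a unanimous step and,
    by \<open>drift\<close>, to \<open>- \<kappa>\<close> in any other. The two kinds of step
    alternate, so the total stays bounded.\<close>
  define \<kappa> where "\<kappa> = (\<Sum>s<3. M s) - 6"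
  define C where "C s = 2 * \<bar>\<alpha> s\<bar> + 2 * \<bar>\<beta> s\<bar> + (\<bar>M s\<bar> + \<bar>m s\<bar> + 2)" for s
  have step: "\<Lambda> s (Suc t, x, y) + 2 = \<Lambda> s (t, x, y) + (if unanimous A b t then M s else m s)" for s t x y
    by (simp add: \<Lambda>_def \<theta>_def)
  have move: "\<Lambda> s (t, x + fst d, y + snd d) = \<Lambda> s (t, x, y) + (\<alpha> s * real_of_int (fst d) + \<beta> s * real_of_int (snd d))" for s t x y d
    by (simp add: \<Lambda>_def algebra_simps)
  have "Toom_certificate \<Lambda> \<bar>\<kappa>\<bar> (\<Sum>s<3. C s) A b"
  proof
    show "near u v \<Longrightarrow> near v u" for u v
      by (auto simp: near_def)
    show "finite {..<3::nat}" "{..<3::nat} \<noteq> {}"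
      by (auto simp: lessThan_empty_iff)
    show "\<bar>\<Sum>s<3. \<Lambda> s v\<bar> \<le> \<bar>\<kappa>\<bar>" for v
    proof -
      obtain t x y where v: "v = (t, x, y)" by (cases v)
      have "(\<Sum>s<3. \<Lambda> s v) = (\<Sum>s<3. \<theta> s t)"
        using sum0 by (simp add: \<Lambda>_def v sum.distrib sum_distrib_right[symmetric])
      also have "\<dots> = (\<Sum>i<t. \<Sum>s<3. (if unanimous A b i then M s else m s) - 2)"
        unfolding \<theta>_def by (rule sum.swap)
      also have "\<dots> = (\<Sum>i<t. if unanimous A b i then \<kappa> else - \<kappa>)"
        using drift by (intro sum.cong) (auto simp: \<kappa>_def sum_subtractf)
      finally show ?thesis
        using alternating_sum_bounded by simp
    qed
    show "0 \<le> (\<Sum>s<3. C s)"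
      by (intro sum_nonneg) (auto simp: C_def)
    show "(\<Sum>s<3. \<bar>\<Lambda> s u - \<Lambda> s v\<bar>) \<le> (\<Sum>s<3. C s)" if "near u v" for u v
    proof (rule sum_mono)
      fix s :: nat
      obtain t x y t' x' y' where q: "u = (t, x, y)" "v = (t', x', y')" by (cases u, cases v)
      have nr: "\<bar>int t - int t'\<bar> \<le> 1" "\<bar>x - x'\<bar> \<le> 2" "\<bar>y - y'\<bar> \<le> 2"
        using that by (auto simp: near_def q)
      then have "t' = t \<or> t' = Suc t \<or> t = Suc t'" by linarith
      then have th: "\<bar>\<theta> s t - \<theta> s t'\<bar> \<le> \<bar>M s\<bar> + \<bar>m s\<bar> + 2"
        by (elim disjE) (auto simp: \<theta>_def)
      have xx: "\<bar>\<alpha> s * x - \<alpha> s * x'\<bar> \<le> \<bar>\<alpha> s\<bar> * 2" "\<bar>\<beta> s * y - \<beta> s * y'\<bar> \<le> \<bar>\<beta> s\<bar> * 2"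
        unfolding right_diff_distrib[symmetric] abs_mult using nr by (intro mult_left_mono; linarith)+
      have "\<Lambda> s u - \<Lambda> s v = (\<alpha> s * x - \<alpha> s * x') + (\<beta> s * y - \<beta> s * y') + (\<theta> s t - \<theta> s t')"
        by (simp add: q \<Lambda>_def)
      also have "\<bar>\<dots>\<bar> \<le> \<bar>\<alpha> s * x - \<alpha> s * x'\<bar> + \<bar>\<beta> s * y - \<beta> s * y'\<bar> + \<bar>\<theta> s t - \<theta> s t'\<bar>"
        by (intro order_trans[OF abs_triangle_ineq] add_right_mono abs_triangle_ineq)
      also have "\<dots> \<le> \<bar>\<alpha> s\<bar> * 2 + \<bar>\<beta> s\<bar> * 2 + (\<bar>M s\<bar> + \<bar>m s\<bar> + 2)"
        using th xx by (intro add_mono)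
      finally show "\<bar>\<Lambda> s u - \<Lambda> s v\<bar> \<le> C s"
        by (simp add: C_def mult.commute)
    qed
    show "\<exists>d\<in>nbhd A t. \<Lambda> s (Suc t, x, y) + 2 \<le> \<Lambda> s (t, x + fst d, y + snd d)"
      if "unanimous A b t" "s < 3" for t s x y
      using M[OF that] that unfolding step move by simp
    show "\<Lambda> s (Suc t, x, y) + 2 \<le> \<Lambda> s (t, x + fst d, y + snd d)"
      if "\<not> unanimous A b t" "s < 3" "d \<in> nbhd A t" for t s d x y
      using m[OF that] that unfolding step move by simp
  qed
  then show ?thesis by blast
qed

lemma sum_lessThan_3: "(\<Sum>s<3. f s) = f 0 + f 1 + f (2 :: nat)" for f :: "nat \<Rightarrow> real"
  by (simp add: eval_nat_numeral)

lemma less_3_cases: "s < 3 \<Longrightarrow> s = 0 \<or> s = 1 \<or> s = (2::nat)"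
  by linarith

lemma Toom_certificate_exists: "\<exists>\<Lambda> c\<^sub>0 c. Toom_certificate \<Lambda> c\<^sub>0 c A b"
proof -
  note defs = unanimous_def sum_lessThan_3
  note cert = Toom_certificateI[where \<alpha> = "\<lambda>s. as ! s" and \<beta> = "\<lambda>s. bs ! s" and M = "\<lambda>s. Ms ! s" and m = "\<lambda>s. ms ! s" for as bs Ms ms]
  show ?thesis
  \<comment> \<open>For R, F and M two opposite directions suffice, and the third functional depends
    on time only. The direction is constant on the neighbourhood of the non-unanimous steps: a strip
    of errors across it keeps its width there and narrows in the unanimous steps.\<close>
  proof (cases A; cases b)
    assume "A = CA_R" b
    then show ?thesis
      by (intro cert[of "[6, -6, 0]" "[0, 0, 0]" "[6, 6, 0]" "[0, 0, 0]"])
        (auto simp: defs split: if_splits dest!: less_3_cases)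
  next
    assume "A = CA_R" "\<not> b"
    then show ?thesis
      by (intro cert[of "[0, 0, 0]" "[6, -6, 0]" "[6, 6, 0]" "[0, 0, 0]"])
        (auto simp: defs split: if_splits dest!: less_3_cases)
  next
    assume "A = CA_F" b
    then show ?thesis
      by (intro cert[of "[8, -8, 0]" "[-4, 4, 0]" "[8, 4, 0]" "[4, -4, 0]"])
        (auto simp: defs split: if_splits dest!: less_3_cases)
  next
    assume "A = CA_F" "\<not> b"
    then show ?thesis
      by (intro cert[of "[4, -4, 0]" "[-8, 8, 0]" "[8, 4, 0]" "[4, -4, 0]"])
        (auto simp: defs split: if_splits dest!: less_3_cases)
  next
    assume "A = CA_M" b
    then show ?thesis
      by (intro cert[of "[6, -6, 0]" "[-6, 6, 0]" "[6, 6, 0]" "[6, -6, 0]"])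
        (auto simp: defs split: if_splits dest!: less_3_cases)
  next
    assume "A = CA_M" "\<not> b"
    then show ?thesis
      by (intro cert[of "[6, -6, 0]" "[6, -6, 0]" "[6, 6, 0]" "[6, -6, 0]"])
        (auto simp: defs split: if_splits dest!: less_3_cases)
  next
    \<comment> \<open>Both kinds of step share one neighbourhood, so with two opposite directions
      the contributions to \<open>drift\<close> would cancel. The inner normals of the triangle
      spanned by the neighbourhood are used instead.\<close>
    assume "A = CA_T" b
    then show ?thesis
      by (intro cert[of "[12, 0, -12]" "[0, -12, 12]" "[12, 12, 0]" "[0, 0, -12]"])
        (auto simp: defs split: if_splits dest!: less_3_cases)
  next
    assume "A = CA_T" "\<not> b"
    then show ?thesis
      by (intro cert[of "[12, 0, -12]" "[0, -12, 12]" "[12, 12, 0]" "[0, 0, -12]"])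
        (auto simp: defs split: if_splits dest!: less_3_cases)
  qed
qed

section \<open>Magnetization and memory time\<close>

text \<open>Chebyshev: the mean count is at most \<open>card I / 8\<close>, so a count above
  \<open>card I / 4\<close> deviates by at least \<open>card I / 8\<close>. Only dependent pairs
  enter the variance, each with at most 1, so it is at most
  \<open>card I * \<Delta>\<close>.\<close>

lemma (in prob_space) many_events_le:
  fixes X :: "'i \<Rightarrow> 'a set" and \<Delta> :: nat
  assumes I: "finite I" "I \<noteq> {}" and X: "\<And>i. i \<in> I \<Longrightarrow> X i \<in> events"
    and le: "\<And>i. i \<in> I \<Longrightarrow> prob (X i) \<le> 1/8"
    and dep: "\<And>i. i \<in> I \<Longrightarrow> card {j\<in>I. prob (X i \<inter> X j) \<noteq> prob (X i) * prob (X j)} \<le> \<Delta>"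
  shows "prob {\<omega> \<in> space M. real (card {i\<in>I. \<omega> \<in> X i}) > card I / 4} \<le> 64 * \<Delta> / card I"
proof -
  define n where "n = real (card I)"
  have n: "n > 0" using I by (simp add: n_def card_gt_0_iff)
  define f where "f \<omega> = (\<Sum>i\<in>I. indicator (X i) \<omega> :: real)" for \<omega>
  have f_card: "f \<omega> = card {i\<in>I. \<omega> \<in> X i}" for \<omega>
    using I by (simp add: f_def indicator_def sum.If_cases Int_def)
  have int_ind: "integrable M (indicator (X i) :: 'a \<Rightarrow> real)" if "i \<in> I" for i
    using X[OF that] by (simp add: integrable_indicator_iff less_top[symmetric])
  have int_ind2: "integrable M (indicator (X i \<inter> X j) :: 'a \<Rightarrow> real)" if "i \<in> I" "j \<in> I" for i j
    using X that by (simp add: integrable_indicator_iff less_top[symmetric])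
  have int: "integrable M f"
    unfolding f_def using int_ind by (intro Bochner_Integration.integrable_sum)
  have f2: "(f \<omega>)\<^sup>2 = (\<Sum>i\<in>I. \<Sum>j\<in>I. indicator (X i \<inter> X j) \<omega>)" for \<omega>
    by (simp add: f_def power2_eq_square sum_product indicator_inter_arith)
  have int2: "integrable M (\<lambda>\<omega>. (f \<omega>)\<^sup>2)"
    unfolding f2 using int_ind2 by (intro Bochner_Integration.integrable_sum)
  have Ef: "expectation f = (\<Sum>i\<in>I. prob (X i))"
    unfolding f_def using int_ind X by (subst Bochner_Integration.integral_sum) (auto intro!: sum.cong)
  have Ef2: "expectation (\<lambda>\<omega>. (f \<omega>)\<^sup>2) = (\<Sum>i\<in>I. \<Sum>j\<in>I. prob (X i \<inter> X j))"
    unfolding f2 using int_ind2 X by (simp add: Bochner_Integration.integral_sum Bochner_Integration.integrable_sum)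
  have "variance f = expectation (\<lambda>\<omega>. (f \<omega>)\<^sup>2) - (expectation f)\<^sup>2"
    by (rule variance_eq[OF int int2])
  also have "\<dots> = (\<Sum>i\<in>I. \<Sum>j\<in>I. prob (X i \<inter> X j) - prob (X i) * prob (X j))"
    unfolding Ef2 unfolding Ef power2_eq_square sum_product by (simp add: sum_subtractf)
  also have "\<dots> \<le> (\<Sum>i\<in>I. real \<Delta>)"
  proof (rule sum_mono)
    fix i assume i: "i \<in> I"
    let ?J = "{j\<in>I. prob (X i \<inter> X j) \<noteq> prob (X i) * prob (X j)}"
    have "(\<Sum>j\<in>I. prob (X i \<inter> X j) - prob (X i) * prob (X j)) = (\<Sum>j\<in>?J. prob (X i \<inter> X j) - prob (X i) * prob (X j))"
      using I by (intro sum.mono_neutral_right) auto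
    also have "\<dots> \<le> (\<Sum>j\<in>?J. 1)"
      by (intro sum_mono) (smt (verit) prob_le_1 measure_nonneg mult_nonneg_nonneg)
    also have "\<dots> \<le> real \<Delta>"
      using dep[OF i] by simp
    finally show "(\<Sum>j\<in>I. prob (X i \<inter> X j) - prob (X i) * prob (X j)) \<le> real \<Delta>" .
  qed
  finally have var: "variance f \<le> n * \<Delta>" by (simp add: n_def)
  have mean: "expectation f \<le> n / 8"
    unfolding Ef using sum_mono[of I "\<lambda>i. prob (X i)" "\<lambda>_. 1/8"] le by (simp add: n_def)
  have "prob {\<omega> \<in> space M. f \<omega> > n / 4} \<le> prob {\<omega> \<in> space M. \<bar>f \<omega> - expectation f\<bar> \<ge> n / 8}"
  proof (rule finite_measure_mono)
    have "n / 8 \<le> \<bar>f \<omega> - expectation f\<bar>" if "f \<omega> > n / 4" for \<omega>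
      using that mean by linarith
    then show "{\<omega> \<in> space M. f \<omega> > n / 4} \<subseteq> {\<omega> \<in> space M. \<bar>f \<omega> - expectation f\<bar> \<ge> n / 8}"
      by blast
  qed (use int in measurable)
  also have "\<dots> \<le> variance f / (n / 8)\<^sup>2"
    using int int2 n by (intro Chebyshev_inequality) auto
  also have "\<dots> \<le> n * \<Delta> / (n / 8)\<^sup>2"
    using var by (intro divide_right_mono) auto
  also have "\<dots> = 64 * \<Delta> / n"
    using n by (simp add: power2_eq_square field_simps)
  finally show ?thesis
    by (simp add: f_card n_def)
qed

section \<open>Finite range of influence and independence of distant errors\<close>

definition influence :: "nat \<Rightarrow> nat \<Rightarrow> site \<Rightarrow> (nat \<times> site) set" where
  "influence L n r = {..<n} \<times> (\<lambda>(x, y). shift L r x y) ` ({-int n..int n} \<times> {-int n..int n})"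

lemma influence_I: "t < n \<Longrightarrow> \<bar>x\<bar> \<le> int n \<Longrightarrow> \<bar>y\<bar> \<le> int n \<Longrightarrow> (t, shift L r x y) \<in> influence L n r"
  by (force simp: influence_def)

lemma influence_shift_subset:
  assumes "L > 0" "d \<in> nbhd A t"
  shows "influence L n (shift L r (fst d) (snd d)) \<subseteq> influence L (Suc n) r"
proof
  fix j assume "j \<in> influence L n (shift L r (fst d) (snd d))"
  then obtain t x y where j: "j = (t, shift L (shift L r (fst d) (snd d)) x y)" "t < n" "\<bar>x\<bar> \<le> int n" "\<bar>y\<bar> \<le> int n"
    by (auto simp: influence_def)
  then show "j \<in> influence L (Suc n) r"
    using nbhd_bounded[OF assms(2)] assms(1) by (auto simp: shift_shift intro!: influence_I)
qed

lemma evolve_cong: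
  assumes "L > 0" "r \<in> torus L" "\<And>j. j \<in> influence L n r \<Longrightarrow> w j = w' j"
  shows "evolve A L w n s r = evolve A L w' n s r"
  using assms(2,3)
proof (induction n arbitrary: r)
  case (Suc n)
  have "w (n, r) = w' (n, r)"
    using Suc.prems influence_I[of n "Suc n" 0 0 L r] shift_zero[of r L] by auto
  moreover have "rule A L n (evolve A L w n s) r = rule A L n (evolve A L w' n s) r"
  proof (rule rule_cong[OF Suc.prems(1)])
    fix d assume d: "d \<in> nbhd A n"
    show "evolve A L w n s (shift L r (fst d) (snd d)) = evolve A L w' n s (shift L r (fst d) (snd d))"
    proof (rule Suc.IH)
      show "shift L r (fst d) (snd d) \<in> torus L"
        by (rule shift_in_torus[OF assms(1)])
      show "w j = w' j" if "j \<in> influence L n (shift L r (fst d) (snd d))" for j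
        using that Suc.prems(2) influence_shift_subset[OF assms(1) d] by blast
    qed
  qed
  ultimately show ?case by (simp split: option.split)
qed simp

lemma rule_measurable:
  assumes [measurable]: "\<And>r. Measurable.pred M (\<lambda>w. e w r)"
  shows "Measurable.pred M (\<lambda>w. rule A L t (e w) r)"
  by (cases A; cases "even t"; simp; measurable)

text \<open>The index set \<open>J\<close> is arbitrary because independence is derived on products
  restricted to influence sets.\<close>

lemma evolve_measurable [measurable]:
  "(\<lambda>w. evolve A L w n s r) \<in> measurable (PiM J (\<lambda>_. measure_pmf N)) (count_space UNIV)"
proof (induction n arbitrary: r)
  case (Suc n)
  note [measurable] = Suc.IH
  have "evolve A L w (Suc n) s r \<longleftrightarrow> w (n, r) = Some True \<or> w (n, r) = None \<and> rule A L n (evolve A L w n s) r" for w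
    by (auto split: option.splits)
  moreover have "Measurable.pred (PiM J (\<lambda>_. measure_pmf N)) (\<lambda>w. rule A L n (evolve A L w n s) r)"
    by (rule rule_measurable) (rule Suc.IH)
  ultimately show ?case by simp
qed simp

lemma evolve_measurable_noise [measurable]:
  "(\<lambda>w. evolve A L w n s r) \<in> measurable (noise_space p \<eta>) (count_space UNIV)"
  unfolding noise_space_def by measurable

lemma indep_vars_noise:
  "prob_space.indep_vars (noise_space p \<eta>) (\<lambda>_. measure_pmf (noise_pmf p \<eta>)) (\<lambda>j w. w j) UNIV"
proof -
  interpret product_prob_space "\<lambda>_. measure_pmf (noise_pmf p \<eta>)" UNIV
    by (rule product_prob_space_noise)
  interpret N: prob_space "noise_space p \<eta>" by (rule prob_space_noise_space)
  show ?thesis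
    by (subst N.indep_vars_iff_distr_eq_PiM')
      (auto simp: noise_space_def PiM_component restrict_UNIV intro!: distr_id)
qed

text \<open>By \<open>evolve_cong\<close> each spin factors through the noise restricted to its
  influence set, and disjoint blocks of independent coordinates are independent.\<close>

lemma errors_independent:
  fixes p \<eta> :: real and A :: CA and s :: config and b :: bool
  assumes L: "L > 0" and r: "r \<in> torus L" "r' \<in> torus L"
    and disj: "influence L n r \<inter> influence L n r' = {}"
  defines "X \<equiv> \<lambda>r. {w \<in> space (noise_space p \<eta>). evolve A L w n s r \<noteq> b}"
  shows "measure (noise_space p \<eta>) (X r \<inter> X r') = measure (noise_space p \<eta>) (X r) * measure (noise_space p \<eta>) (X r')"
proof -
  interpret N: prob_space "noise_space p \<eta>" by (rule prob_space_noise_space)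
  let ?N = "\<lambda>_::nat \<times> site. measure_pmf (noise_pmf p \<eta>)"
  define g where "g = (\<lambda>r w. evolve A L w n s r)"
  define Y where "Y r w = g r (restrict w (influence L n r))" for r w
  have Y: "Y r w = g r w" if "r \<in> torus L" for r w
    unfolding Y_def g_def using L that by (intro evolve_cong) auto
  have "N.indep_var (count_space UNIV) (g r \<circ> (\<lambda>w. restrict (\<lambda>j. w j) (influence L n r)))
      (count_space UNIV) (g r' \<circ> (\<lambda>w. restrict (\<lambda>j. w j) (influence L n r')))"
    using N.indep_var_restrict[OF indep_vars_noise disj]
    by (intro N.indep_var_compose[of "PiM (influence L n r) ?N" _ "PiM (influence L n r') ?N"]) (auto simp: g_def)
  then have "N.indep_var (count_space UNIV) (g r) (count_space UNIV) (g r')"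
    using r Y by (simp add: Y_def comp_def)
  from N.indep_varD[OF this, of "{\<not> b}" "{\<not> b}"]
  show ?thesis
    by (simp add: X_def g_def vimage_def Int_def conj_commute)
qed

text \<open>A shared site is within \<open>n\<close> of both centres, so \<open>r'\<close> arises
  from \<open>r\<close> by a displacement of at most \<open>2 * n\<close> per coordinate.\<close>

lemma card_influence_meet_le:
  assumes "L > 0"
  shows "card {r'\<in>torus L. influence L n r \<inter> influence L n r' \<noteq> {}} \<le> (4 * n + 1)\<^sup>2"
proof -
  let ?B = "{- 2 * int n..2 * int n} \<times> {- 2 * int n..2 * int n}"
  have "{r'\<in>torus L. influence L n r \<inter> influence L n r' \<noteq> {}} \<subseteq> (\<lambda>(x, y). shift L r x y) ` ?B"
  proof
    fix r' assume "r' \<in> {r'\<in>torus L. influence L n r \<inter> influence L n r' \<noteq> {}}"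
    then obtain x y x' y' where r': "r' \<in> torus L" and eq: "shift L r x y = shift L r' x' y'"
      and bd: "\<bar>x\<bar> \<le> int n" "\<bar>y\<bar> \<le> int n" "\<bar>x'\<bar> \<le> int n" "\<bar>y'\<bar> \<le> int n"
      by (auto simp: influence_def abs_le_iff) (metis minus_le_iff)
    have "r' = shift L (shift L r' x' y') (- x') (- y')"
      using assms r' by (simp add: shift_shift shift_zero)
    also have "\<dots> = shift L r (x - x') (y - y')"
      unfolding eq[symmetric] using assms by (simp add: shift_shift)
    finally show "r' \<in> (\<lambda>(x, y). shift L r x y) ` ?B"
      using bd by (intro image_eqI[of _ _ "(x - x', y - y')"]) auto
  qed
  then have "card {r'\<in>torus L. influence L n r \<inter> influence L n r' \<noteq> {}} \<le> card ((\<lambda>(x, y). shift L r x y) ` ?B)"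
    by (intro card_mono) auto
  also have "\<dots> \<le> card ?B"
    by (intro card_image_le) auto
  also have "\<dots> = (4 * n + 1)\<^sup>2"
    by (simp add: card_cartesian_product power2_eq_square nat_add_distrib nat_mult_distrib)
  finally show ?thesis .
qed

lemma card_torus: "card (torus L) = L\<^sup>2"
  by (simp add: torus_def card_cartesian_product power2_eq_square)

lemma finite_torus: "finite (torus L)"
  by (simp add: torus_def)

text \<open>The threshold 1/32 makes the error probability at most 4/32 = 1/8, as
  \<open>many_events_le\<close> requires.\<close>

lemma (in Toom_certificate) prob_many_errors_le:
  assumes p: "0 \<le> p" "p \<le> 1" and small: "150 ^ K * p \<le> 1/32" and L: "2 * n < L"
  shows "measure (noise_space p \<eta>)
      {w \<in> space (noise_space p \<eta>). real (card {r\<in>torus L. evolve A L w n (\<lambda>_. b) r \<noteq> b}) > real (L\<^sup>2) / 4}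
    \<le> 64 * (4 * real n + 1)\<^sup>2 / (real L)\<^sup>2"
proof -
  interpret N: prob_space "noise_space p \<eta>" by (rule prob_space_noise_space)
  define X where "X r = {w \<in> space (noise_space p \<eta>). evolve A L w n (\<lambda>_. b) r \<noteq> b}" for r
  have "torus L \<noteq> {}"
    using L by (auto simp: torus_def)
  moreover have "X r \<in> sets (noise_space p \<eta>)" for r
    unfolding X_def by measurable
  moreover have "measure (noise_space p \<eta>) (X r) \<le> 1/8" if "r \<in> torus L" for r
    using prob_error_le[OF p _ L that, of \<eta>] small unfolding X_def by simp
  moreover have "card {r'\<in>torus L. measure (noise_space p \<eta>) (X r \<inter> X r')
        \<noteq> measure (noise_space p \<eta>) (X r) * measure (noise_space p \<eta>) (X r')} \<le> (4 * n + 1)\<^sup>2"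
    if r: "r \<in> torus L" for r
  proof -
    have "{r'\<in>torus L. measure (noise_space p \<eta>) (X r \<inter> X r')
        \<noteq> measure (noise_space p \<eta>) (X r) * measure (noise_space p \<eta>) (X r')}
      \<subseteq> {r'\<in>torus L. influence L n r \<inter> influence L n r' \<noteq> {}}"
      using errors_independent[OF _ r, of _ n p \<eta> A "\<lambda>_. b" b] L unfolding X_def by auto
    then have "card {r'\<in>torus L. measure (noise_space p \<eta>) (X r \<inter> X r')
        \<noteq> measure (noise_space p \<eta>) (X r) * measure (noise_space p \<eta>) (X r')}
      \<le> card {r'\<in>torus L. influence L n r \<inter> influence L n r' \<noteq> {}}"
      using finite_torus by (intro card_mono) auto
    also have "\<dots> \<le> (4 * n + 1)\<^sup>2"
      using L by (intro card_influence_meet_le) simp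
    finally show ?thesis .
  qed
  ultimately have "measure (noise_space p \<eta>) {w \<in> space (noise_space p \<eta>).
       real (card {r\<in>torus L. w \<in> X r}) > card (torus L) / 4} \<le> 64 * ((4 * n + 1)\<^sup>2) / card (torus L)"
    using finite_torus by (intro N.many_events_le) auto
  then show ?thesis
    by (simp add: X_def card_torus add.commute)
qed

section \<open>From error counts to the expected relaxation time\<close>

lemma magn_eq_errors:
  assumes "L > 0"
  shows "(if b then 1 else -1) * magn L s = 1 - 2 * real (card {r\<in>torus L. s r \<noteq> b}) / real (L\<^sup>2)"
proof -
  have "(\<Sum>r\<in>torus L. (if b then 1 else -1) * (if s r then 1 else -1 :: real))
      = (\<Sum>r\<in>torus L. 1 - 2 * (if s r \<noteq> b then 1 else 0))"
    by (intro sum.cong) auto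
  also have "\<dots> = real (L\<^sup>2) - 2 * (\<Sum>r\<in>torus L. if s r \<noteq> b then 1 else 0)"
    unfolding sum_subtractf sum_distrib_left[symmetric] by (simp add: card_torus)
  also have "(\<Sum>r\<in>torus L. if s r \<noteq> b then 1 else 0 :: real) = card {r\<in>torus L. s r \<noteq> b}"
    using finite_torus by (simp add: sum.If_cases Int_def)
  finally have "(if b then 1 else -1) * (\<Sum>r\<in>torus L. if s r then 1 else -1 :: real)
      = real (L\<^sup>2) - 2 * real (card {r\<in>torus L. s r \<noteq> b})"
    unfolding sum_distrib_left .
  then show ?thesis
    using assms by (simp add: magn_def field_simps)
qed

lemma magn_below_half_iff:
  assumes "L > 0"
  shows "(if b then 1 else -1) * magn L s < 1/2 \<longleftrightarrow> real (card {r\<in>torus L. s r \<noteq> b}) > real (L\<^sup>2) / 4"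
  unfolding magn_eq_errors[OF assms] using assms by (simp add: field_simps)

lemma first_time_ge:
  assumes "\<And>t. t < T \<Longrightarrow> \<not> P t"
  shows "of_nat T \<le> first_time P"
proof (cases "\<exists>t. P t")
  case True
  then have "T \<le> (LEAST t. P t)"
    using assms LeastI_ex[OF True] by (meson not_le)
  then show ?thesis using True by (simp add: first_time_def)
qed (auto simp: first_time_def)

text \<open>There are \<open>2 * T\<close> bad events, one per initial state and time below
  \<open>T\<close>. With probability at least 1/2 none occurs, and then relaxation takes at least
  \<open>T\<close> steps.\<close>

lemma t_mem_ge:
  assumes small: "\<And>b n. n < T \<Longrightarrow> measure (noise_space p \<eta>)
      {w \<in> space (noise_space p \<eta>). real (card {r\<in>torus L. evolve A L w n (\<lambda>_. b) r \<noteq> b}) > real (L\<^sup>2) / 4} \<le> \<delta>"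
    and \<delta>: "2 * real T * \<delta> \<le> 1/2" and L: "L > 0"
  shows "ennreal (real T / 2) \<le> t_mem A L p \<eta>"
proof -
  interpret N: prob_space "noise_space p \<eta>" by (rule prob_space_noise_space)
  define B where "B = (\<lambda>(b, n). {w \<in> space (noise_space p \<eta>).
      real (card {r\<in>torus L. evolve A L w n (\<lambda>_. b) r \<noteq> b}) > real (L\<^sup>2) / 4})"
  define I where "I = (UNIV :: bool set) \<times> {..<T}"
  define G where "G = space (noise_space p \<eta>) - (\<Union>i\<in>I. B i)"
  have B_meas: "B i \<in> N.events" for i
  proof -
    obtain b n where i: "i = (b, n)" by (cases i)
    have eq: "real (card {r\<in>torus L. evolve A L w n (\<lambda>_. b) r \<noteq> b})
        = (\<Sum>r\<in>torus L. if evolve A L w n (\<lambda>_. b) r \<noteq> b then 1 else 0)" for w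
      using finite_torus by (simp add: sum.If_cases Int_def)
    show ?thesis
      unfolding B_def i prod.case eq by measurable
  qed
  have G_meas: "G \<in> N.events"
    unfolding G_def using B_meas by (intro sets.Diff sets.top sets.finite_UN) (auto simp: I_def)
  have "N.prob (\<Union>i\<in>I. B i) \<le> (\<Sum>i\<in>I. N.prob (B i))"
    using B_meas by (intro N.finite_measure_subadditive_finite) (auto simp: I_def)
  also have "\<dots> \<le> (\<Sum>i\<in>I. \<delta>)"
    using small by (intro sum_mono) (auto simp: I_def B_def)
  also have "\<dots> \<le> 1/2"
    using \<delta> by (simp add: I_def card_cartesian_product)
  finally have G: "1/2 \<le> N.prob G"
    unfolding G_def using B_meas by (subst N.prob_compl) (auto simp: I_def)
  have relax: "of_nat T \<le> relax_time A L w" if "w \<in> G" for w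
  proof -
    have "\<not> (if b then 1 else -1) * magn L (evolve A L w n (\<lambda>_. b)) < 1/2" if "n < T" for b n
      unfolding magn_below_half_iff[OF L] using \<open>w \<in> G\<close> that by (auto simp: G_def B_def I_def)
    from this[of _ True] this[of _ False] show ?thesis
      unfolding relax_time_def by (intro min.boundedI first_time_ge) auto
  qed
  have "ennreal (real T / 2) = ennreal (real T) * ennreal (1/2)"
    by (subst ennreal_mult[symmetric]) auto
  also have "\<dots> \<le> of_nat T * emeasure (noise_space p \<eta>) G"
    unfolding N.emeasure_eq_measure using G by (intro mult_mono ennreal_leI) (auto simp: ennreal_of_nat_eq_real_of_nat)
  also have "\<dots> = (\<integral>\<^sup>+ w. of_nat T * indicator G w \<partial>noise_space p \<eta>)"
    by (rule nn_integral_cmult_indicator[symmetric, OF G_meas])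
  also have "\<dots> \<le> t_mem A L p \<eta>"
    unfolding t_mem_def using relax by (intro nn_integral_mono) (auto simp: indicator_def)
  finally show ?thesis .
qed

lemma robust_memory_all: "robust_memory A"
proof -
  obtain \<Lambda>\<^sub>1 a\<^sub>1 c\<^sub>1 \<Lambda>\<^sub>2 a\<^sub>2 c\<^sub>2 where "Toom_certificate \<Lambda>\<^sub>1 a\<^sub>1 c\<^sub>1 A True" "Toom_certificate \<Lambda>\<^sub>2 a\<^sub>2 c\<^sub>2 A False"
    using Toom_certificate_exists by metis
  then interpret P: Toom_certificate \<Lambda>\<^sub>1 a\<^sub>1 c\<^sub>1 A True + Q: Toom_certificate \<Lambda>\<^sub>2 a\<^sub>2 c\<^sub>2 A False .
  \<comment> \<open>The larger constant serves both initial states; \<open>p\<^sub>0\<close> is then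
    independent of \<open>L\<close> and of the time horizon.\<close>
  define k where "k = max P.K Q.K"
  define p\<^sub>0 :: real where "p\<^sub>0 = 1 / (32 * 150 ^ k)"
  have p\<^sub>0: "0 < p\<^sub>0" "p\<^sub>0 \<le> 1"
  proof -
    have "(1::real) \<le> 32 * 150 ^ k"
      using one_le_power[of "150::real" k] by linarith
    then show "0 < p\<^sub>0" "p\<^sub>0 \<le> 1"
      by (auto simp: p\<^sub>0_def)
  qed
  have ball: "0 < p \<and> p < p\<^sub>0 \<and> -1 \<le> \<eta> \<and> \<eta> \<le> 1" if "(p, \<eta>) \<in> ball (p\<^sub>0 / 2, 0) (p\<^sub>0 / 2)" for p \<eta> :: real
  proof -
    have "dist (p\<^sub>0 / 2) p < p\<^sub>0 / 2" "dist 0 \<eta> < p\<^sub>0 / 2"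
      using that dist_fst_le[of "(p\<^sub>0 / 2, 0)" "(p, \<eta>)"] dist_snd_le[of "(p\<^sub>0 / 2, 0)" "(p, \<eta>)"] by auto
    then show ?thesis
      using p\<^sub>0 unfolding dist_real_def by linarith
  qed
  have lim: "((\<lambda>L. t_mem A L p \<eta>) \<longlongrightarrow> \<infinity>) sequentially" if "(p, \<eta>) \<in> ball (p\<^sub>0 / 2, 0) (p\<^sub>0 / 2)" for p \<eta> :: real
  proof -
    have p: "0 \<le> p" "p \<le> 1" "p \<le> p\<^sub>0"
      using ball[OF that] p\<^sub>0 by auto
    have small: "150 ^ j * p \<le> 1/32" if "j \<le> k" for j
    proof -
      have "(150::real) ^ j * p \<le> 150 ^ k * p\<^sub>0"
        using that p by (intro mult_mono power_increasing) auto
      then show ?thesis by (simp add: p\<^sub>0_def)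
    qed
    have errs: "measure (noise_space p \<eta>)
        {w \<in> space (noise_space p \<eta>). real (card {r\<in>torus L. evolve A L w n (\<lambda>_. b) r \<noteq> b}) > real (L\<^sup>2) / 4}
      \<le> 64 * (4 * real n + 1)\<^sup>2 / (real L)\<^sup>2" if "2 * n < L" for b n L
      using P.prob_many_errors_le[OF p(1,2) small that, of \<eta>] Q.prob_many_errors_le[OF p(1,2) small that, of \<eta>]
      by (cases b) (auto simp: k_def)
    \<comment> \<open>The horizon \<open>T\<close> is fixed while \<open>L\<close> grows, so the
      total probability of the bad events tends to 0; \<open>T\<close> itself is arbitrary.\<close>
    have ev: "eventually (\<lambda>L. ennreal (real T / 2) \<le> t_mem A L p \<eta>) sequentially" for T :: nat
    proof -
      define \<delta> where "\<delta> L = 64 * (4 * real T + 1)\<^sup>2 / (real L)\<^sup>2" for L :: nat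
      have "(\<lambda>L. 2 * real T * \<delta> L) \<longlonglongrightarrow> 0"
        unfolding \<delta>_def by real_asymp
      then have "eventually (\<lambda>L. 2 * real T * \<delta> L < 1/2) sequentially"
        by (rule order_tendstoD) simp
      then show ?thesis
        using eventually_gt_at_top[of "2 * T"]
      proof eventually_elim
        case (elim L)
        show ?case
        proof (rule t_mem_ge)
          fix b n assume n: "n < T"
          have "64 * (4 * real n + 1)\<^sup>2 / (real L)\<^sup>2 \<le> \<delta> L"
            unfolding \<delta>_def using n by (intro divide_right_mono mult_left_mono power_mono) auto
          with errs[of n L b] elim(2) n
          show "measure (noise_space p \<eta>) {w \<in> space (noise_space p \<eta>).
              real (card {r\<in>torus L. evolve A L w n (\<lambda>_. b) r \<noteq> b}) > real (L\<^sup>2) / 4} \<le> \<delta> L"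
            by linarith
        qed (use elim in auto)
      qed
    qed
    have "eventually (\<lambda>L. ennreal l < t_mem A L p \<eta>) sequentially" if "l \<ge> 0" for l
    proof -
      obtain T :: nat where "2 * l < real T"
        using reals_Archimedean2 by blast
      then have "ennreal l < ennreal (real T / 2)"
        using that by (simp add: ennreal_less_iff)
      then show ?thesis
        using ev[of T] by (auto elim: eventually_mono intro: less_le_trans)
    qed
    then show ?thesis
      unfolding infinity_ennreal_def tendsto_top_iff_ennreal by blast
  qed
  show ?thesis
    unfolding robust_memory_def
  proof (intro exI conjI)
    show "ball (p\<^sub>0 / 2, 0 :: real) (p\<^sub>0 / 2) \<subseteq> {0..1} \<times> {-1..1}"
    proof
      fix z assume "z \<in> ball (p\<^sub>0 / 2, 0 :: real) (p\<^sub>0 / 2)"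
      then show "z \<in> {0..1} \<times> {-1..1}"
        using ball[of "fst z" "snd z"] p\<^sub>0 by (auto simp: mem_Times_iff)
    qed
  qed (use lim p\<^sub>0 in auto)
qed

theorem theorem1:
  shows "\<forall>A \<in> {CA_R, CA_F, CA_M, CA_T}. robust_memory A"
  using robust_memory_all by blast

end
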